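(* Let $d_1,n\ge1$, $d_2\ge 2$ and $s\ge 1$ be integers. Consider the varying index coefficient model $$y=\sum_{j=1}^{d_2}z_j\, f_j(\langle X,\theta_j^\star\rangle)+\varepsilon,$$ where $X\in\mathbb{R}^{d_1}$ and $Z=(z_1,\dots,z_{d_2})^T\in\mathbb{R}^{d_2}$ are independent random vectors, $\mathbb{E}[\varepsilon\mid X,Z]=0$, and $\theta_j^\star\in\mathbb{R}^{d_1}$ with $\|\theta_j^\star\|_2=1$ and $\|\theta_j^\star\|_0=s$ for all $j\in[d_2]$. Suppose: (A1) $X$ has a (known) differentiable density $p:\mathbb{R}^{d_1}\to\mathbb{R}$; the functions $f_j$ are differentiable with $\mu_j^\star:=\mathbb{E}[f_j'(\langle X,\theta_j^\star\rangle)]\neq0$ for all $j\in[d_2]$; $\mathbb{E}[Z]=0$; and, with $\Sigma^\star:=\mathbb{E}[ZZ^T]$ and $\Omega^\star:=(\Sigma^\star)^{-1}$, one has $\Omega^\star\succ0$, $\|\Omega^\star\|_{L_1}\le\varpi$ and $\max_{1\le i\le d_2}\sum_{j=1}^{d_2}|(\Omega^\star)_{i,j}|^q\le K$ for some $\varpi$, $K$ and $q\in[0,1)$. (A2) There is an absolute constant $M>0$ such that $\mathbb{E}[y^4]\vee\mathbb{E}\big[[S(X)]_j^4\big]\vee\mathbb{E}[z_k^4]\le M$ for all $j\in[d_1]$, $k\in[d_2]$, where $S(X):=-\nabla p(X)/p(X)$. Let $(y_i,X_i,Z_i)_{i=1}^n$ be i.i.d. samples from the model. Let $\Theta^\star=(\theta_1^\star,\dots,\theta_{d_2}^\star)\in\mathbb{R}^{d_1\times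 d_2}$ and $\widetilde\Theta=(\mu_1^\star\theta_1^\star,\dots,\mu_{d_2}^\star\theta_{d_2}^\star)\in\mathbb{R}^{d_1\times d_2}$. Let $\widehat\Theta$ be the element-wise truncated estimator defined in the context, with tuning parameters, for $j\in[d_1]$ and $k,l\in[d_2]$, $$\tau^{(1)}_{j,k}\asymp M^{3/4}\sqrt{\frac{n}{\log(d_1d_2)}},\qquad \tau^{(2)}_{k,l}\asymp M^{1/2}\sqrt{\frac{n}{\log d_2}},\qquad \gamma\asymp M^{1/2}\varpi\sqrt{\frac{\log d_2}{n}},$$ $$\lambda=8M^{3/4}\|\Omega^\star\|_{1,1}\sqrt{\frac{3\log(d_1d_2)}{n}}+16\max_{j\in[d_2]}|\mu_j^\star|\cdot\|\Theta^\star\Sigma^\star\|_\infty M^{1/2}\varpi^2\sqrt{\frac{4\log d_2}{n}}.$$ Here the three relations $\asymp$ mean that the parameters equal the displayed quantities multiplied by suitable positive absolute constants; that is, the claim is that there exist absolute constants $c_1,c_2,c_3>0$ such that the following holds when $\tau^{(1)}_{j,k}$, $\tau^{(2)}_{k,l}$, $\gamma$ equal $c_1,c_2,c_3$ times the respective displayed quantities. Then, with probability at least $1-\frac{2}{(d_1d_2)^2}-\frac1{d_2^2}-\frac1{d_2^3}$, $$\|\widehat\Theta-\widetilde\Theta\|_F\le 2\lambda\sqrt{s d_2}\qquad\text{and}\qquad\|\widehat\Theta-\widetilde\Theta\|_{1,1}\le 8\lambda s d_2.$$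
   Context: Notation: $[m]=\{1,\dots,m\}$; $a\vee b=\max(a,b)$; $a\wedge b=\min(a,b)$; $\langle A,B\rangle=\operatorname{tr}(A^TB)$ for matrices (Euclidean inner product for vectors); $\|v\|_0$ is the number of nonzero entries of $v$. For $A=(a_{ij})\in\mathbb{R}^{m_1\times m_2}$: $\|A\|_F$ is the Frobenius norm, $\|A\|_{\max}=\max_{i,j}|a_{ij}|$, $\|A\|_{1,1}=\sum_{i,j}|a_{ij}|$, $\|A\|_\infty=\max_i\sum_j|a_{ij}|$ (maximum absolute row sum), $\|A\|_{L_1}=\max_j\sum_i|a_{ij}|$ (maximum absolute column sum). $\Omega\succ0$ means positive definite. Truncation: for $\tau>0$, $\psi_\tau(x)=(|x|\wedge\tau)\operatorname{sign}(x)$. For a matrix of thresholds $\Gamma_1=(\tau^{(1)}_{j,k})_{j\in[d_1],k\in[d_2]}$ and $A\in\mathbb{R}^{d_1\times d_2}$, $\psi_{\Gamma_1}(A)$ is the matrix with entries $\psi_{\tau^{(1)}_{j,k}}(a_{jk})$. Estimator: write $Z_i=(z_1^{(i)},\dots,z_{d_2}^{(i)})^T$. First define $\widehat\Sigma_n\in\mathbb{R}^{d_2\times d_2}$ by $(\widehat\Sigma_n)_{k,l}=\frac1n\sum_{i=1}^n\psi_{\tau^{(2)}_{k,l}}\big(z_k^{(i)}z_l^{(i)}\big)$, and let $\widehat\Omega$ be a solution of $$\min_{\Omega\in\mathbb{R}^{d_2\times d_2}}\|\Omega\|_{1,1}\quad\text{subject to}\quad\|\widehat\Sigma_n\Omega-I_{d_2}\|_{\max}\le\gamma.$$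 Then $$\widehat\Theta=\underset{\Theta\in\mathbb{R}^{d_1\times d_2}}{\operatorname{argmin}}\Big\{\|\Theta\|_F^2-2\Big\langle\frac1n\sum_{i=1}^n\psi_{\Gamma_1}\big(y_iS(X_i)Z_i^T\big)\widehat\Omega,\ \Theta\Big\rangle+\lambda\|\Theta\|_{1,1}\Big\}.$$ (If the constraint set defining $\widehat\Omega$ is empty for a realization of the data, $\widehat\Omega$ may be defined arbitrarily there.) *)

theory Defs
  imports "HOL-Probability.Probability" "Jordan_Normal_Form.Matrix"
begin

text \<open>Points of \<open>\<real>\<^sup>d\<close> are functions \<open>nat \<Rightarrow> real\<close> in \<open>extensional {..<d}\<close>, the carrier
  of the product measure spaces over \<open>{..<d}\<close>. Matrices are those of \<^theory>\<open>Jordan_Normal_Form.Matrix\<close>;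
  all indices are 0-based.\<close>

section \<open>Matrix norms\<close>

definition frob_norm :: "real mat \<Rightarrow> real" where
  "frob_norm A = sqrt (\<Sum>i<dim_row A. \<Sum>j<dim_col A. (A $$ (i, j))\<^sup>2)"

definition max_norm :: "real mat \<Rightarrow> real" where
  "max_norm A = Max ((\<lambda>(i, j). \<bar>A $$ (i, j)\<bar>) ` ({..<dim_row A} \<times> {..<dim_col A}))"

definition l11_norm :: "real mat \<Rightarrow> real" where
  "l11_norm A = (\<Sum>i<dim_row A. \<Sum>j<dim_col A. \<bar>A $$ (i, j)\<bar>)"

definition row_sum_norm :: "real mat \<Rightarrow> real" where
  "row_sum_norm A = Max ((\<lambda>i. \<Sum>j<dim_col A. \<bar>A $$ (i, j)\<bar>) ` {..<dim_row A})"

definition col_sum_norm :: "real mat \<Rightarrow> real" where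
  "col_sum_norm A = Max ((\<lambda>j. \<Sum>i<dim_row A. \<bar>A $$ (i, j)\<bar>) ` {..<dim_col A})"

text \<open>The trace of \<open>A\<^sup>T B\<close>.\<close>

definition mat_inner :: "real mat \<Rightarrow> real mat \<Rightarrow> real" where
  "mat_inner A B = (\<Sum>i<dim_col A. (transpose_mat A * B) $$ (i, i))"

definition pos_def_mat :: "real mat \<Rightarrow> bool" where
  "pos_def_mat A \<longleftrightarrow> square_mat A \<and> transpose_mat A = A \<and>
     (\<forall>v \<in> carrier_vec (dim_row A). v \<noteq> 0\<^sub>v (dim_row A) \<longrightarrow> 0 < v \<bullet> (A *\<^sub>v v))"

section \<open>Differentiability on \<open>\<real>\<^sup>d\<close> and the score function\<close>

abbreviation borel_vec :: "nat \<Rightarrow> (nat \<Rightarrow> real) measure" where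
  "borel_vec d \<equiv> Pi\<^sub>M {..<d} (\<lambda>_. borel)"

abbreviation lborel_vec :: "nat \<Rightarrow> (nat \<Rightarrow> real) measure" where
  "lborel_vec d \<equiv> Pi\<^sub>M {..<d} (\<lambda>_. lborel)"

text \<open>Total (Frechet) differentiability at every point; the type \<open>nat \<Rightarrow> real\<close> carries no norm,
  so the library's notion does not apply.\<close>

definition differentiable_vec :: "nat \<Rightarrow> ((nat \<Rightarrow> real) \<Rightarrow> real) \<Rightarrow> bool" where
  "differentiable_vec d p \<longleftrightarrow>
     (\<forall>x \<in> extensional {..<d}. \<exists>g :: nat \<Rightarrow> real. \<forall>e>0. \<exists>\<delta>>0. \<forall>h \<in> extensional {..<d}.
        L2_set h {..<d} < \<delta> \<longrightarrow>
        \<bar>p (\<lambda>i\<in>{..<d}. x i + h i) - p x - (\<Sum>i<d. g i * h i)\<bar> \<le> e * L2_set h {..<d})"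

definition partial_deriv :: "((nat \<Rightarrow> real) \<Rightarrow> real) \<Rightarrow> nat \<Rightarrow> (nat \<Rightarrow> real) \<Rightarrow> real" where
  "partial_deriv p j x = deriv (\<lambda>t. p (x(j := t))) (x j)"

text \<open>Component \<open>j\<close> of \<open>S(x) = - \<nabla>p(x) / p(x)\<close>. Where \<open>p\<close> vanishes the value is \<open>0\<close>; this
  happens with probability zero when \<open>p\<close> is the density of \<open>X\<close>.\<close>

definition score :: "((nat \<Rightarrow> real) \<Rightarrow> real) \<Rightarrow> (nat \<Rightarrow> real) \<Rightarrow> nat \<Rightarrow> real" where
  "score p x j = - partial_deriv p j x / p x"

section \<open>The varying index coefficient model\<close>

text \<open>A model is given by the joint law \<open>P\<close> of \<open>(X, Z, \<epsilon>)\<close> on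
  \<open>\<real>\<^bsup>d1\<^esup> \<times> \<real>\<^bsup>d2\<^esup> \<times> \<real>\<close>, and \<open>n\<close> i.i.d. samples are the coordinates of the \<open>n\<close>-fold product
  of \<open>P\<close>. Every i.i.d. sample on any probability space has this law, so nothing is lost; unlike a
  sample space of arbitrary type, this allows constants to be quantified independently of
  the probability space.\<close>

type_synonym obs = "(nat \<Rightarrow> real) \<times> (nat \<Rightarrow> real) \<times> real"

definition covX :: "obs \<Rightarrow> nat \<Rightarrow> real" where "covX \<omega> = fst \<omega>"
definition covZ :: "obs \<Rightarrow> nat \<Rightarrow> real" where "covZ \<omega> = fst (snd \<omega>)"
definition noise :: "obs \<Rightarrow> real" where "noise \<omega> = snd (snd \<omega>)"

definition proj_index :: "real mat \<Rightarrow> nat \<Rightarrow> (nat \<Rightarrow> real) \<Rightarrow> real" where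
  "proj_index \<Theta> j x = (\<Sum>i<dim_row \<Theta>. x i * \<Theta> $$ (i, j))"

definition response :: "(nat \<Rightarrow> real \<Rightarrow> real) \<Rightarrow> real mat \<Rightarrow> obs \<Rightarrow> real" where
  "response f \<Theta> \<omega> = (\<Sum>j<dim_col \<Theta>. covZ \<omega> j * f j (proj_index \<Theta> j (covX \<omega>))) + noise \<omega>"

definition sigma_XZ :: "nat \<Rightarrow> nat \<Rightarrow> obs measure \<Rightarrow> obs measure" where
  "sigma_XZ d1 d2 P =
     vimage_algebra (space P) (\<lambda>\<omega>. (covX \<omega>, covZ \<omega>)) (borel_vec d1 \<Otimes>\<^sub>M borel_vec d2)"

text \<open>The columns of \<open>\<Theta>\<close> are the index vectors.\<close>

definition vic_model :: "nat \<Rightarrow> nat \<Rightarrow> nat \<Rightarrow> obs measure \<Rightarrow> real mat \<Rightarrow> bool" where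
  "vic_model d1 d2 s P \<Theta> \<longleftrightarrow>
     prob_space P \<and>
     sets P = sets (borel_vec d1 \<Otimes>\<^sub>M (borel_vec d2 \<Otimes>\<^sub>M (borel :: real measure))) \<and>
     prob_space.indep_var P (borel_vec d1) covX (borel_vec d2) covZ \<and>
     integrable P noise \<and>
     (AE \<omega> in P. real_cond_exp P (sigma_XZ d1 d2 P) noise \<omega> = 0) \<and>
     \<Theta> \<in> carrier_mat d1 d2 \<and>
     (\<forall>j<d2. L2_set (\<lambda>i. \<Theta> $$ (i, j)) {..<d1} = 1 \<and>
             card {i. i < d1 \<and> \<Theta> $$ (i, j) \<noteq> 0} = s)"

definition mean_deriv ::
    "obs measure \<Rightarrow> (nat \<Rightarrow> real \<Rightarrow> real) \<Rightarrow> real mat \<Rightarrow> nat \<Rightarrow> real" where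
  "mean_deriv P f \<Theta> j = (\<integral>\<omega>. deriv (f j) (proj_index \<Theta> j (covX \<omega>)) \<partial>P)"

definition second_moment :: "nat \<Rightarrow> obs measure \<Rightarrow> real mat" where
  "second_moment d2 P = mat d2 d2 (\<lambda>(k, l). \<integral>\<omega>. covZ \<omega> k * covZ \<omega> l \<partial>P)"

text \<open>Below, \<open>powr\<close> satisfies \<open>0 powr 0 = 0\<close>, so for \<open>q = 0\<close> the row sums count nonzero
  entries.\<close>

definition assumption_A1 ::
    "nat \<Rightarrow> nat \<Rightarrow> obs measure \<Rightarrow> ((nat \<Rightarrow> real) \<Rightarrow> real) \<Rightarrow> (nat \<Rightarrow> real \<Rightarrow> real) \<Rightarrow> real mat
     \<Rightarrow> real mat \<Rightarrow> real \<Rightarrow> real \<Rightarrow> real \<Rightarrow> bool" where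
  "assumption_A1 d1 d2 P p f \<Theta> \<Omega> varpi K q \<longleftrightarrow>
     (\<forall>x \<in> extensional {..<d1}. 0 \<le> p x) \<and>
     distributed P (lborel_vec d1) covX (\<lambda>x. ennreal (p x)) \<and>
     differentiable_vec d1 p \<and>
     (\<forall>j<d2. \<forall>t. f j differentiable (at t)) \<and>
     (\<forall>j<d2. integrable P (\<lambda>\<omega>. deriv (f j) (proj_index \<Theta> j (covX \<omega>))) \<and>
             mean_deriv P f \<Theta> j \<noteq> 0) \<and>
     (\<forall>k<d2. integrable P (\<lambda>\<omega>. covZ \<omega> k) \<and> (\<integral>\<omega>. covZ \<omega> k \<partial>P) = 0) \<and>
     \<Omega> \<in> carrier_mat d2 d2 \<and>
     inverts_mat (second_moment d2 P) \<Omega> \<and> inverts_mat \<Omega> (second_moment d2 P) \<and>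
     pos_def_mat \<Omega> \<and>
     col_sum_norm \<Omega> \<le> varpi \<and>
     0 \<le> q \<and> q < 1 \<and>
     Max ((\<lambda>i. \<Sum>j<d2. \<bar>\<Omega> $$ (i, j)\<bar> powr q) ` {..<d2}) \<le> K"

text \<open>Integrability is stated explicitly because the Bochner integral of a non-integrable function
  is \<open>0\<close>.\<close>

definition assumption_A2 ::
    "nat \<Rightarrow> nat \<Rightarrow> obs measure \<Rightarrow> ((nat \<Rightarrow> real) \<Rightarrow> real) \<Rightarrow> (nat \<Rightarrow> real \<Rightarrow> real) \<Rightarrow> real mat
     \<Rightarrow> real \<Rightarrow> bool" where
  "assumption_A2 d1 d2 P p f \<Theta> M \<longleftrightarrow>
     0 < M \<and>
     integrable P (\<lambda>\<omega>. response f \<Theta> \<omega> ^ 4) \<and> (\<integral>\<omega>. response f \<Theta> \<omega> ^ 4 \<partial>P) \<le> M \<and>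
     (\<forall>j<d1. integrable P (\<lambda>\<omega>. score p (covX \<omega>) j ^ 4) \<and>
             (\<integral>\<omega>. score p (covX \<omega>) j ^ 4 \<partial>P) \<le> M) \<and>
     (\<forall>k<d2. integrable P (\<lambda>\<omega>. covZ \<omega> k ^ 4) \<and> (\<integral>\<omega>. covZ \<omega> k ^ 4 \<partial>P) \<le> M)"

definition Theta_tilde :: "obs measure \<Rightarrow> (nat \<Rightarrow> real \<Rightarrow> real) \<Rightarrow> real mat \<Rightarrow> real mat" where
  "Theta_tilde P f \<Theta> =
     mat (dim_row \<Theta>) (dim_col \<Theta>) (\<lambda>(i, j). mean_deriv P f \<Theta> j * \<Theta> $$ (i, j))"

section \<open>The element-wise truncated estimator\<close>

definition trunc :: "real \<Rightarrow> real \<Rightarrow> real" where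
  "trunc \<tau> x = min \<bar>x\<bar> \<tau> * sgn x"

text \<open>A data set of size \<open>n\<close> is a function \<open>\<omega> :: nat \<Rightarrow> obs\<close>, of which only the values on
  \<open>{..<n}\<close> matter. The estimator sees an observation only through \<open>(y, X, Z)\<close>.\<close>

definition Sigma_hat :: "nat \<Rightarrow> nat \<Rightarrow> (nat \<Rightarrow> nat \<Rightarrow> real) \<Rightarrow> (nat \<Rightarrow> obs) \<Rightarrow> real mat" where
  "Sigma_hat n d2 \<tau>2 \<omega> = mat d2 d2 (\<lambda>(k, l).
     1 / real n * (\<Sum>i<n. trunc (\<tau>2 k l) (covZ (\<omega> i) k * covZ (\<omega> i) l)))"

definition cross_hat ::
    "nat \<Rightarrow> nat \<Rightarrow> nat \<Rightarrow> (nat \<Rightarrow> nat \<Rightarrow> real) \<Rightarrow> ((nat \<Rightarrow> real) \<Rightarrow> real)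
     \<Rightarrow> (nat \<Rightarrow> real) \<Rightarrow> (nat \<Rightarrow> obs) \<Rightarrow> real mat" where
  "cross_hat n d1 d2 \<tau>1 p y \<omega> = mat d1 d2 (\<lambda>(j, k).
     1 / real n * (\<Sum>i<n. trunc (\<tau>1 j k) (y i * score p (covX (\<omega> i)) j * covZ (\<omega> i) k)))"

definition Omega_feasible :: "nat \<Rightarrow> real mat \<Rightarrow> real \<Rightarrow> real mat \<Rightarrow> bool" where
  "Omega_feasible d2 Sh \<gamma> W \<longleftrightarrow>
     W \<in> carrier_mat d2 d2 \<and> max_norm (Sh * W - 1\<^sub>m d2) \<le> \<gamma>"

definition is_Omega_hat :: "nat \<Rightarrow> real mat \<Rightarrow> real \<Rightarrow> real mat \<Rightarrow> bool" where
  "is_Omega_hat d2 Sh \<gamma> W \<longleftrightarrow>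
     W \<in> carrier_mat d2 d2 \<and>
     ((\<exists>V. Omega_feasible d2 Sh \<gamma> V) \<longrightarrow> is_arg_min l11_norm (Omega_feasible d2 Sh \<gamma>) W)"

definition is_Theta_hat ::
    "nat \<Rightarrow> nat \<Rightarrow> real mat \<Rightarrow> real mat \<Rightarrow> real \<Rightarrow> real mat \<Rightarrow> bool" where
  "is_Theta_hat d1 d2 C W lam T \<longleftrightarrow>
     is_arg_min (\<lambda>T. (frob_norm T)\<^sup>2 - 2 * mat_inner (C * W) T + lam * l11_norm T)
       (\<lambda>T. T \<in> carrier_mat d1 d2) T"

end

theory Submission
  imports Defs
begin

text \<open>The objective decouples over entries, so \<open>Theta_hat\<close> is a soft thresholding of
  \<open>B = cross_hat * Omega_hat\<close>, and everything reduces to showing that every entry of \<open>B\<close> is within \<open>lam / 2\<close> of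
  the target. Stein's identity, integration by parts against the density of \<open>X\<close>, identifies the mean of
  \<open>y S(X) Z\<^sup>T\<close> as \<open>Theta_tilde * \<Sigma>\<close>; the independence of \<open>X\<close> and \<open>Z\<close> bounds its second moments by
  \<open>M\<^bsup>3/2\<^esup>\<close>, although fourth moments of the factors alone would not. Chernoff bounds for means of
  truncated samples then control both empirical matrices. On the resulting event \<open>\<Omega>\<close> is feasible in the
  optimisation defining \<open>Omega_hat\<close>, so no column of \<open>Omega_hat\<close> has a larger absolute sum than that
  of \<open>\<Omega>\<close>.\<close>

section \<open>Thresholding and the inverse covariance estimate\<close>

text \<open>The moment assumptions concern \<open>y\<close>, the score and \<open>Z\<close>, never a
  single link function, while Stein's identity needs each \<open>f l\<close> and its product with
  the score to be integrable. Only \<open>signal\<close>, the sum of all link terms, is within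
  direct reach; the single terms must be recovered from it through the invertibility of \<Sigma>.

  The good event is defined by the data alone, before any estimator is chosen. On it the bounds hold
  for every minimiser, so no measurable selection is made, and feasibility of \<Omega> rules out the
  case in which \<open>Omega_hat\<close> is arbitrary.

  The budget \<open>lam / 2\<close> per entry has two parts matching the two summands of
  \<open>lam\<close>: the deviation of \<open>cross_hat\<close> summed against a column of
  \<open>Omega_hat\<close>, and the target times the residual of \<open>Omega_hat\<close> as an
  inverse of \<Sigma>. The free constants are fixed by confidence levels: with second moment
  \<open>v\<close>, the threshold is \<open>sqrt (v * n / t)\<close>, where \<open>t\<close> is
  \<open>3 * ln (d1 * d2)\<close> for the cross moments and \<open>5 * ln d2\<close> for the
  covariances.\<close>

lemma mult_mat_index_sum:
  assumes "A \<in> carrier_mat m n" "B \<in> carrier_mat n r" "i < m" "j < r"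
  shows "(A * B) $$ (i, j) = (\<Sum>k<n. A $$ (i, k) * B $$ (k, j))"
  using assms by (simp add: scalar_prod_def atLeast0LessThan)

lemma mat_inner_eq_sum:
  assumes "A \<in> carrier_mat m n" "B \<in> carrier_mat m n"
  shows "mat_inner A B = (\<Sum>j<n. \<Sum>i<m. A $$ (i, j) * B $$ (i, j))"
proof -
  have "(transpose_mat A * B) $$ (j, j) = (\<Sum>i<m. A $$ (i, j) * B $$ (i, j))" if "j < n" for j
    using assms that by (simp add: scalar_prod_def atLeast0LessThan)
  then show ?thesis
    using assms by (simp add: mat_inner_def)
qed

lemma max_norm_le_iff:
  assumes "A \<in> carrier_mat m n" "0 < m" "0 < n"
  shows "max_norm A \<le> g \<longleftrightarrow> (\<forall>i<m. \<forall>j<n. \<bar>A $$ (i, j)\<bar> \<le> g)"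
proof -
  have "{..<m} \<times> {..<n} \<noteq> {}" using assms by (auto simp: lessThan_empty_iff)
  then have "max_norm A \<le> g \<longleftrightarrow>
      (\<forall>x\<in>(\<lambda>(i, j). \<bar>A $$ (i, j)\<bar>) ` ({..<m} \<times> {..<n}). x \<le> g)"
    unfolding max_norm_def using assms by (subst Max_le_iff) auto
  then show ?thesis by auto
qed

lemma col_sum_norm_ge:
  assumes "A \<in> carrier_mat m n" "j < n"
  shows "(\<Sum>i<m. \<bar>A $$ (i, j)\<bar>) \<le> col_sum_norm A"
  using assms unfolding col_sum_norm_def by (intro Max_ge) auto

lemma row_sum_norm_ge:
  assumes "A \<in> carrier_mat m n" "i < m"
  shows "(\<Sum>j<n. \<bar>A $$ (i, j)\<bar>) \<le> row_sum_norm A"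
  using assms unfolding row_sum_norm_def by (intro Max_ge) auto

lemma row_sum_norm_nonneg:
  assumes "A \<in> carrier_mat m n" "0 < m"
  shows "0 \<le> row_sum_norm A"
  using order_trans[OF sum_nonneg row_sum_norm_ge[OF assms]] by simp

lemma l11_norm_nonneg: "0 \<le> l11_norm A"
  by (auto simp: l11_norm_def intro!: sum_nonneg)

lemma col_sum_le_l11_norm:
  assumes "A \<in> carrier_mat m n" "j < n"
  shows "(\<Sum>i<m. \<bar>A $$ (i, j)\<bar>) \<le> l11_norm A"
  using assms unfolding l11_norm_def by (auto intro!: sum_mono member_le_sum)

text \<open>Two competitors suffice in place of the closed form. Taking \<open>u = b\<close> gives
  \<open>(t - b)\<^sup>2 \<le> lam * \<bar>t - b\<bar>\<close>, hence
  \<open>\<bar>t - b\<bar> \<le> lam\<close>, and with the error of \<open>b\<close> a total of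
  \<open>3/2 * lam\<close>, which \<open>2 * lam\<close> covers. Taking \<open>u = 0\<close> shows
  that a coordinate with \<open>\<bar>b\<bar> \<le> lam / 2\<close> is set exactly to zero.\<close>

lemma soft_threshold_error:
  fixes t b \<theta> lam :: real
  assumes min: "\<And>u. t\<^sup>2 - 2 * b * t + lam * \<bar>t\<bar> \<le> u\<^sup>2 - 2 * b * u + lam * \<bar>u\<bar>"
    and b: "\<bar>b - \<theta>\<bar> \<le> lam / 2"
  shows "\<bar>t - \<theta>\<bar> \<le> 2 * lam" and "\<theta> = 0 \<Longrightarrow> t = 0"
proof -
  have lam: "0 \<le> lam" using b by linarith
  have "(t - b)\<^sup>2 \<le> lam * (\<bar>b\<bar> - \<bar>t\<bar>)"
    using min[of b] by (simp add: power2_eq_square algebra_simps)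
  also have "\<dots> \<le> lam * \<bar>t - b\<bar>"
    using lam by (intro mult_left_mono) linarith+
  finally have "\<bar>t - b\<bar> * \<bar>t - b\<bar> \<le> lam * \<bar>t - b\<bar>"
    by (simp add: power2_eq_square flip: abs_mult)
  then have "\<bar>t - b\<bar> \<le> lam"
    using lam mult_right_le_imp_le[of "\<bar>t - b\<bar>" "\<bar>t - b\<bar>" lam] by (cases "t = b") simp_all
  then show "\<bar>t - \<theta>\<bar> \<le> 2 * lam" using b lam by linarith
  assume "\<theta> = 0"
  then have "2 * b * t \<le> lam * \<bar>t\<bar>"
    using b mult_right_mono[of "2 * \<bar>b\<bar>" lam "\<bar>t\<bar>"] abs_ge_self[of "b * t"]
    by (simp add: abs_mult)
  moreover have "t\<^sup>2 - 2 * b * t + lam * \<bar>t\<bar> \<le> 0" using min[of 0] by simp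
  ultimately have "t\<^sup>2 \<le> 0" by linarith
  then show "t = 0" by simp
qed

lemma is_Theta_hat_entry_min:
  assumes C: "C \<in> carrier_mat d1 d2" and W: "W \<in> carrier_mat d2 d2"
    and T: "is_Theta_hat d1 d2 C W lam T" and ij: "i < d1" "j < d2"
  shows "(T $$ (i, j))\<^sup>2 - 2 * (C * W) $$ (i, j) * T $$ (i, j) + lam * \<bar>T $$ (i, j)\<bar>
    \<le> u\<^sup>2 - 2 * (C * W) $$ (i, j) * u + lam * \<bar>u\<bar>"
proof -
  define B where "B = C * W"
  define I where "I = {..<d1} \<times> {..<d2}"
  define \<phi> where "\<phi> = (\<lambda>k (v::real). v\<^sup>2 - 2 * B $$ k * v + lam * \<bar>v\<bar>)"
  have BC: "B \<in> carrier_mat d1 d2" using C W by (simp add: B_def)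
  have obj: "(frob_norm V)\<^sup>2 - 2 * mat_inner (C * W) V + lam * l11_norm V = (\<Sum>k\<in>I. \<phi> k (V $$ k))"
    if V: "V \<in> carrier_mat d1 d2" for V
  proof -
    have "(frob_norm V)\<^sup>2 = (\<Sum>k\<in>I. (V $$ k)\<^sup>2)"
      using V by (simp add: frob_norm_def I_def sum.cartesian_product sum_nonneg case_prod_beta)
    moreover have "mat_inner (C * W) V = (\<Sum>k\<in>I. B $$ k * V $$ k)"
      unfolding B_def[symmetric] mat_inner_eq_sum[OF BC V]
      by (subst sum.swap) (simp add: I_def sum.cartesian_product case_prod_beta)
    moreover have "l11_norm V = (\<Sum>k\<in>I. \<bar>V $$ k\<bar>)"
      using V by (simp add: l11_norm_def I_def sum.cartesian_product case_prod_beta)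
    ultimately show ?thesis
      by (simp add: \<phi>_def sum.distrib sum_subtractf sum_distrib_left mult.assoc)
  qed
  have TC: "T \<in> carrier_mat d1 d2" and opt: "\<And>V. V \<in> carrier_mat d1 d2 \<Longrightarrow>
      (\<Sum>k\<in>I. \<phi> k (T $$ k)) \<le> (\<Sum>k\<in>I. \<phi> k (V $$ k))"
    using T obj unfolding is_Theta_hat_def is_arg_min_linorder by auto
  \<comment> \<open>The competitor differs from \<open>T\<close> in the single entry
    \<open>(i, j)\<close>, so all other summands of the objective cancel.\<close>
  define V where "V = mat d1 d2 (\<lambda>k. if k = (i, j) then u else T $$ k)"
  have "(\<Sum>k\<in>I. \<phi> k (T $$ k)) \<le> (\<Sum>k\<in>I. \<phi> k (V $$ k))"
    by (rule opt) (simp add: V_def)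
  moreover have "(\<Sum>k\<in>I - {(i, j)}. \<phi> k (V $$ k)) = (\<Sum>k\<in>I - {(i, j)}. \<phi> k (T $$ k))"
  proof (intro sum.cong refl)
    fix k assume "k \<in> I - {(i, j)}"
    then have "V $$ k = T $$ k" by (auto simp: V_def I_def split: if_splits)
    then show "\<phi> k (V $$ k) = \<phi> k (T $$ k)" by simp
  qed
  moreover have "(i, j) \<in> I" "finite I" using ij by (auto simp: I_def)
  ultimately have "\<phi> (i, j) (T $$ (i, j)) \<le> \<phi> (i, j) (V $$ (i, j))"
    by (simp add: sum.remove)
  then show ?thesis using ij by (simp add: \<phi>_def V_def B_def)
qed

text \<open>Off the support of \<Theta> the estimate is exactly zero; on the support, at most
  \<open>s\<close> entries per column, it is off by at most \<open>2 * lam\<close>. Both norms then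
  follow by counting.\<close>

lemma lasso_error_bounds:
  assumes C: "C \<in> carrier_mat d1 d2" and W: "W \<in> carrier_mat d2 d2"
    and T: "is_Theta_hat d1 d2 C W lam T" and \<Theta>: "\<Theta> \<in> carrier_mat d1 d2"
    and lam: "0 \<le> lam"
    and sparse: "\<And>j. j < d2 \<Longrightarrow> card {i. i < d1 \<and> \<Theta> $$ (i, j) \<noteq> 0} \<le> s"
    and close: "\<And>i j. i < d1 \<Longrightarrow> j < d2 \<Longrightarrow> \<bar>(C * W) $$ (i, j) - \<Theta> $$ (i, j)\<bar> \<le> lam / 2"
  shows "frob_norm (T - \<Theta>) \<le> 2 * lam * sqrt (real (s * d2))"
    and "l11_norm (T - \<Theta>) \<le> 2 * lam * real s * real d2"
proof -
  \<comment> \<open>One count serves both norms: \<open>F\<close> is the square for the Frobenius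
    norm and the identity for the entrywise sum.\<close>
  have sum_bound: "(\<Sum>i<d1. \<Sum>j<d2. F \<bar>(T - \<Theta>) $$ (i, j)\<bar>) \<le> real (s * d2) * F (2 * lam)"
    if F: "F 0 = 0" "mono_on {0..} F" for F :: "real \<Rightarrow> real"
  proof -
    have F0: "0 \<le> F (2 * lam)" using mono_onD[OF F(2), of 0 "2 * lam"] F(1) lam by simp
    have "(\<Sum>i<d1. F \<bar>(T - \<Theta>) $$ (i, j)\<bar>) \<le> real s * F (2 * lam)" if j: "j < d2" for j
    proof -
      note opt = is_Theta_hat_entry_min[OF C W T _ j]
      have "(\<Sum>i<d1. F \<bar>(T - \<Theta>) $$ (i, j)\<bar>)
          \<le> (\<Sum>i<d1. if \<Theta> $$ (i, j) \<noteq> 0 then F (2 * lam) else 0)"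
      proof (intro sum_mono)
        fix i assume "i \<in> {..<d1}"
        then have i: "i < d1" by simp
        have "(T - \<Theta>) $$ (i, j) = T $$ (i, j) - \<Theta> $$ (i, j)"
          using \<Theta> i j by simp
        then show "F \<bar>(T - \<Theta>) $$ (i, j)\<bar> \<le> (if \<Theta> $$ (i, j) \<noteq> 0 then F (2 * lam) else 0)"
          using soft_threshold_error[OF opt[OF i] close[OF i j]] F(1)
          by (auto intro!: mono_onD[OF F(2)])
      qed
      also have "\<dots> = real (card {i. i < d1 \<and> \<Theta> $$ (i, j) \<noteq> 0}) * F (2 * lam)"
        by (simp add: sum.If_cases Collect_conj_eq lessThan_def)
      also have "\<dots> \<le> real s * F (2 * lam)"
        using sparse[OF j] F0 by (intro mult_right_mono) auto
      finally show ?thesis .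
    qed
    then have "(\<Sum>j<d2. \<Sum>i<d1. F \<bar>(T - \<Theta>) $$ (i, j)\<bar>) \<le> (\<Sum>j<d2. real s * F (2 * lam))"
      by (intro sum_mono) auto
    then show ?thesis by (subst sum.swap) (simp add: algebra_simps)
  qed
  have "(\<Sum>i<d1. \<Sum>j<d2. ((T - \<Theta>) $$ (i, j))\<^sup>2) \<le> real (s * d2) * (2 * lam)\<^sup>2"
    using sum_bound[of "\<lambda>x. x\<^sup>2"] by (auto simp: mono_on_def power_mono)
  then have "frob_norm (T - \<Theta>) \<le> sqrt (real (s * d2) * (2 * lam)\<^sup>2)"
    using \<Theta> by (simp add: frob_norm_def)
  then show "frob_norm (T - \<Theta>) \<le> 2 * lam * sqrt (real (s * d2))"
    using lam by (simp add: real_sqrt_mult mult.commute mult.left_commute)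
  show "l11_norm (T - \<Theta>) \<le> 2 * lam * real s * real d2"
    using sum_bound[of "\<lambda>x. x"] \<Theta> by (simp add: l11_norm_def mono_on_def algebra_simps)
qed

text \<open>The constraints and the objective decouple over columns, so exchanging a single column
  of a minimiser for that of another feasible matrix cannot decrease its sum.\<close>

lemma clime_col_sum_le:
  assumes Sh: "Sh \<in> carrier_mat d d"
    and W: "is_arg_min l11_norm (Omega_feasible d Sh \<gamma>) W"
    and V: "Omega_feasible d Sh \<gamma> V" and j: "j < d"
  shows "(\<Sum>i<d. \<bar>W $$ (i, j)\<bar>) \<le> (\<Sum>i<d. \<bar>V $$ (i, j)\<bar>)"
proof -
  have d: "0 < d" using j by simp
  have entry: "(Sh * A - 1\<^sub>m d) $$ (i, k) = (\<Sum>l<d. Sh $$ (i, l) * A $$ (l, k)) - (if i = k then 1 else 0)"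
    if "A \<in> carrier_mat d d" "i < d" "k < d" for A i k
    using that Sh by (simp add: mult_mat_index_sum[OF Sh] del: index_mult_mat(1))
  have feasible_iff: "Omega_feasible d Sh \<gamma> A \<longleftrightarrow> A \<in> carrier_mat d d \<and>
      (\<forall>i<d. \<forall>k<d. \<bar>(\<Sum>l<d. Sh $$ (i, l) * A $$ (l, k)) - (if i = k then 1 else 0)\<bar> \<le> \<gamma>)" for A
  proof (cases "A \<in> carrier_mat d d")
    case True
    then have "Sh * A - 1\<^sub>m d \<in> carrier_mat d d" using Sh by auto
    then show ?thesis
      using True by (simp add: Omega_feasible_def max_norm_le_iff[OF _ d d] entry
        del: index_mult_mat index_minus_mat)
  qed (simp add: Omega_feasible_def)
  have W': "Omega_feasible d Sh \<gamma> W" and opt: "\<And>A. Omega_feasible d Sh \<gamma> A \<Longrightarrow> l11_norm W \<le> l11_norm A"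
    using W by (auto simp: is_arg_min_linorder)
  have WC: "W \<in> carrier_mat d d" using W' by (simp add: Omega_feasible_def)
  define A where "A = mat d d (\<lambda>(i, k). if k = j then V $$ (i, k) else W $$ (i, k))"
  have "Omega_feasible d Sh \<gamma> A"
    unfolding feasible_iff
  proof (intro conjI allI impI)
    fix i k assume "i < d" "k < d"
    moreover have "(\<Sum>l<d. Sh $$ (i, l) * A $$ (l, k)) =
        (\<Sum>l<d. Sh $$ (i, l) * (if k = j then V else W) $$ (l, k))"
      using \<open>k < d\<close> by (intro sum.cong) (auto simp: A_def)
    ultimately show "\<bar>(\<Sum>l<d. Sh $$ (i, l) * A $$ (l, k)) - (if i = k then 1 else 0)\<bar> \<le> \<gamma>"
      using W' V unfolding feasible_iff by (cases "k = j") auto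
  qed (simp add: A_def)
  then have "l11_norm W \<le> l11_norm A" by (rule opt)
  moreover have "l11_norm B = (\<Sum>k<d. \<Sum>i<d. \<bar>B $$ (i, k)\<bar>)" if "B \<in> carrier_mat d d" for B
    using that unfolding l11_norm_def by (subst sum.swap) simp
  moreover have "A \<in> carrier_mat d d" by (simp add: A_def)
  ultimately have "(\<Sum>k<d. \<Sum>i<d. \<bar>W $$ (i, k)\<bar>) \<le> (\<Sum>k<d. \<Sum>i<d. \<bar>A $$ (i, k)\<bar>)"
    using WC by metis
  moreover have "(\<Sum>k\<in>{..<d} - {j}. \<Sum>i<d. \<bar>A $$ (i, k)\<bar>) = (\<Sum>k\<in>{..<d} - {j}. \<Sum>i<d. \<bar>W $$ (i, k)\<bar>)"
    by (intro sum.cong) (auto simp: A_def)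
  ultimately have "(\<Sum>i<d. \<bar>W $$ (i, j)\<bar>) \<le> (\<Sum>i<d. \<bar>A $$ (i, j)\<bar>)"
    using j by (simp add: sum.remove[of "{..<d}" j])
  also have "\<dots> = (\<Sum>i<d. \<bar>V $$ (i, j)\<bar>)"
    using j by (intro sum.cong) (auto simp: A_def)
  finally show ?thesis .
qed

text \<open>Split \<open>C W - \<Theta>' = (C - \<Theta>' \<Sigma>) W + \<Theta>' (\<Sigma> W - I)\<close>. Since \<open>\<Theta>' \<Sigma>\<close> need not be dominated by
  \<open>\<Theta> \<Sigma>\<close>, the second term is controlled through \<open>\<Theta> = (\<Theta> \<Sigma>) \<Omega>\<close>, which bounds the absolute row sums
  of \<open>\<Theta>\<close>.\<close>

lemma plug_in_error_bound:
  assumes C: "C \<in> carrier_mat d1 d2" and \<Theta>: "\<Theta> \<in> carrier_mat d1 d2"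
    and \<Theta>': "\<Theta>' \<in> carrier_mat d1 d2"
    and \<Sigma>: "\<Sigma> \<in> carrier_mat d2 d2" and Sh: "Sh \<in> carrier_mat d2 d2" and \<Omega>: "\<Omega> \<in> carrier_mat d2 d2"
    and inv: "\<Sigma> * \<Omega> = 1\<^sub>m d2" and sym: "transpose_mat \<Omega> = \<Omega>"
    and \<mu>: "\<And>i j. i < d1 \<Longrightarrow> j < d2 \<Longrightarrow> \<bar>\<Theta>' $$ (i, j)\<bar> \<le> m * \<bar>\<Theta> $$ (i, j)\<bar>" "0 \<le> m"
    and C_err: "\<And>i j. i < d1 \<Longrightarrow> j < d2 \<Longrightarrow> \<bar>C $$ (i, j) - (\<Theta>' * \<Sigma>) $$ (i, j)\<bar> \<le> e1"
    and Sh_err: "\<And>i j. i < d2 \<Longrightarrow> j < d2 \<Longrightarrow> \<bar>Sh $$ (i, j) - \<Sigma> $$ (i, j)\<bar> \<le> e2"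
    and varpi: "col_sum_norm \<Omega> \<le> varpi" and \<gamma>: "\<gamma> = e2 * varpi"
    and W: "is_Omega_hat d2 Sh \<gamma> W" and ij: "i < d1" "j < d2"
  shows "\<bar>(C * W) $$ (i, j) - \<Theta>' $$ (i, j)\<bar> \<le>
    e1 * l11_norm \<Omega> + 2 * \<gamma> * (m * row_sum_norm (\<Theta> * \<Sigma>) * varpi)"
proof -
  have e: "0 \<le> e1" "0 \<le> e2" using C_err[OF ij] Sh_err[OF ij(2,2)] by linarith+
  have \<Omega>_col: "(\<Sum>l<d2. \<bar>\<Omega> $$ (l, k)\<bar>) \<le> varpi" if "k < d2" for k
    using col_sum_norm_ge[OF \<Omega> that] varpi by linarith
  have \<Omega>_sym: "\<Omega> $$ (k, l) = \<Omega> $$ (l, k)" if "k < d2" "l < d2" for k l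
    using sym \<Omega> that by (metis carrier_matD index_transpose_mat(1))
  have varpi0: "0 \<le> varpi" using \<Omega>_col[OF ij(2)] by (meson order_trans sum_nonneg abs_ge_zero)
  have \<gamma>0: "0 \<le> \<gamma>" using e varpi0 \<gamma> by simp
  have inv': "(\<Sum>l<d2. \<Sigma> $$ (k, l) * \<Omega> $$ (l, k')) = (if k = k' then 1 else 0)"
    if "k < d2" "k' < d2" for k k'
    using mult_mat_index_sum[OF \<Sigma> \<Omega> that] inv that by simp
  \<comment> \<open>Hoelder's inequality: maximum norm of \<open>Sh - \<Sigma>\<close> against the
    absolute sum of a column. It is used for \<open>A = \<Omega>\<close>, to get feasibility, and
    for \<open>A = W\<close>, to pass from \<open>Sh\<close> back to \<Sigma>.\<close>
  have pert: "\<bar>\<Sum>l<d2. (Sh $$ (k, l) - \<Sigma> $$ (k, l)) * A $$ (l, k')\<bar> \<le> \<gamma>"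
    if "k < d2" "(\<Sum>l<d2. \<bar>A $$ (l, k')\<bar>) \<le> varpi" for k k' and A :: "real mat"
  proof -
    have "\<bar>\<Sum>l<d2. (Sh $$ (k, l) - \<Sigma> $$ (k, l)) * A $$ (l, k')\<bar> \<le> (\<Sum>l<d2. e2 * \<bar>A $$ (l, k')\<bar>)"
      using that Sh_err by (intro sum_abs[THEN order_trans] sum_mono) (auto simp: abs_mult mult_right_mono)
    also have "\<dots> \<le> \<gamma>"
      unfolding \<gamma> sum_distrib_left[symmetric] using that(2) e by (intro mult_left_mono)
    finally show ?thesis .
  qed
  have dim: "Sh * A - 1\<^sub>m d2 \<in> carrier_mat d2 d2" if "A \<in> carrier_mat d2 d2" for A
    using that Sh by auto
  have entry: "(Sh * A - 1\<^sub>m d2) $$ (k, k') = (\<Sum>l<d2. Sh $$ (k, l) * A $$ (l, k')) - (if k = k' then 1 else 0)"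
    if "A \<in> carrier_mat d2 d2" "k < d2" "k' < d2" for A k k'
    using that Sh by (simp add: mult_mat_index_sum[OF Sh] del: index_mult_mat(1))
  have feas: "Omega_feasible d2 Sh \<gamma> \<Omega>"
  proof -
    have "\<bar>(Sh * \<Omega> - 1\<^sub>m d2) $$ (k, k')\<bar> \<le> \<gamma>" if "k < d2" "k' < d2" for k k'
      using pert[OF that(1) \<Omega>_col[OF that(2)]] inv'[OF that] that
      by (simp add: entry[OF \<Omega> that] left_diff_distrib sum_subtractf)
    then show ?thesis
      using \<Omega> ij max_norm_le_iff[OF dim[OF \<Omega>]] by (auto simp: Omega_feasible_def)
  qed
  have WC: "W \<in> carrier_mat d2 d2" and W_min: "is_arg_min l11_norm (Omega_feasible d2 Sh \<gamma>) W"
    using W feas unfolding is_Omega_hat_def by blast+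
  have W_feas: "\<bar>(Sh * W - 1\<^sub>m d2) $$ (k, k')\<bar> \<le> \<gamma>" if "k < d2" "k' < d2" for k k'
    using W_min that max_norm_le_iff[OF dim[OF WC]]
    by (auto simp: is_arg_min_def Omega_feasible_def)
  have W_col: "(\<Sum>l<d2. \<bar>W $$ (l, j)\<bar>) \<le> (\<Sum>l<d2. \<bar>\<Omega> $$ (l, j)\<bar>)"
    by (rule clime_col_sum_le[OF Sh W_min feas ij(2)])
  \<comment> \<open>One \<gamma> is the constraint satisfied by \<open>W\<close>, the other the
    price of replacing \<open>Sh\<close> by \<Sigma>; the latter needs the column sums of
    \<open>W\<close> to be at most \<open>varpi\<close>, which \<open>W_col\<close>
    provides.\<close>
  have resid: "\<bar>(\<Sum>l<d2. \<Sigma> $$ (k, l) * W $$ (l, j)) - (if k = j then 1 else 0)\<bar> \<le> 2 * \<gamma>"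
    if k: "k < d2" for k
    using W_feas[OF k ij(2)] pert[OF k order_trans[OF W_col \<Omega>_col[OF ij(2)]]]
    unfolding entry[OF WC k ij(2)] left_diff_distrib sum_subtractf by linarith
  have \<Theta>_row: "(\<Sum>k<d2. \<bar>\<Theta> $$ (i, k)\<bar>) \<le> row_sum_norm (\<Theta> * \<Sigma>) * varpi"
  proof -
    have "\<Theta> * \<Sigma> * \<Omega> = \<Theta>"
      using assoc_mult_mat[OF \<Theta> \<Sigma> \<Omega>] inv \<Theta> by simp
    then have "\<Theta> $$ (i, k) = (\<Sum>l<d2. (\<Theta> * \<Sigma>) $$ (i, l) * \<Omega> $$ (l, k))" if "k < d2" for k
      using mult_mat_index_sum[OF mult_carrier_mat[OF \<Theta> \<Sigma>] \<Omega> ij(1) that] by simp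
    then have "(\<Sum>k<d2. \<bar>\<Theta> $$ (i, k)\<bar>) \<le> (\<Sum>k<d2. \<Sum>l<d2. \<bar>(\<Theta> * \<Sigma>) $$ (i, l)\<bar> * \<bar>\<Omega> $$ (l, k)\<bar>)"
      by (intro sum_mono) (auto intro!: sum_abs[THEN order_trans] simp: abs_mult simp del: index_mult_mat)
    also have "\<dots> = (\<Sum>l<d2. \<bar>(\<Theta> * \<Sigma>) $$ (i, l)\<bar> * (\<Sum>k<d2. \<bar>\<Omega> $$ (l, k)\<bar>))"
      by (subst sum.swap) (simp add: sum_distrib_left)
    \<comment> \<open>Symmetry of \<Omega> turns its row sums into column sums, which
      \<open>varpi\<close> bounds.\<close>
    also have "\<dots> \<le> (\<Sum>l<d2. \<bar>(\<Theta> * \<Sigma>) $$ (i, l)\<bar> * varpi)"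
      using \<Omega>_col \<Omega>_sym by (intro sum_mono mult_left_mono) auto
    also have "\<dots> \<le> row_sum_norm (\<Theta> * \<Sigma>) * varpi"
      unfolding sum_distrib_right[symmetric]
      using row_sum_norm_ge[OF mult_carrier_mat[OF \<Theta> \<Sigma>] ij(1)] varpi0 by (intro mult_right_mono)
    finally show ?thesis .
  qed
  have \<Theta>'_row: "(\<Sum>k<d2. \<bar>\<Theta>' $$ (i, k)\<bar>) \<le> m * row_sum_norm (\<Theta> * \<Sigma>) * varpi"
  proof -
    have "(\<Sum>k<d2. \<bar>\<Theta>' $$ (i, k)\<bar>) \<le> (\<Sum>k<d2. m * \<bar>\<Theta> $$ (i, k)\<bar>)"
      using \<mu>(1) ij by (intro sum_mono) auto
    also have "\<dots> \<le> m * (row_sum_norm (\<Theta> * \<Sigma>) * varpi)"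
      unfolding sum_distrib_left[symmetric] using \<Theta>_row \<mu>(2) by (intro mult_left_mono)
    finally show ?thesis by (simp add: mult.assoc)
  qed
  have "(C * W) $$ (i, j) - \<Theta>' $$ (i, j) =
      (\<Sum>k<d2. (C $$ (i, k) - (\<Theta>' * \<Sigma>) $$ (i, k)) * W $$ (k, j))
      + (\<Sum>k<d2. \<Theta>' $$ (i, k) * ((\<Sum>l<d2. \<Sigma> $$ (k, l) * W $$ (l, j)) - (if k = j then 1 else 0)))"
  proof -
    have "(\<Sum>k<d2. (\<Theta>' * \<Sigma>) $$ (i, k) * W $$ (k, j)) = (\<Theta>' * \<Sigma> * W) $$ (i, j)"
      using mult_mat_index_sum[OF mult_carrier_mat[OF \<Theta>' \<Sigma>] WC ij] by simp
    also have "\<dots> = (\<Theta>' * (\<Sigma> * W)) $$ (i, j)"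
      using assoc_mult_mat[OF \<Theta>' \<Sigma> WC] by simp
    also have "\<dots> = (\<Sum>k<d2. \<Theta>' $$ (i, k) * (\<Sigma> * W) $$ (k, j))"
      using mult_mat_index_sum[OF \<Theta>' mult_carrier_mat[OF \<Sigma> WC] ij] by simp
    also have "\<dots> = (\<Sum>k<d2. \<Theta>' $$ (i, k) * (\<Sum>l<d2. \<Sigma> $$ (k, l) * W $$ (l, j)))"
      using mult_mat_index_sum[OF \<Sigma> WC _ ij(2)] by (intro sum.cong) (auto simp del: index_mult_mat)
    finally have "(\<Sum>k<d2. (\<Theta>' * \<Sigma>) $$ (i, k) * W $$ (k, j)) = \<dots>" .
    moreover have "(\<Sum>k<d2. \<Theta>' $$ (i, k) * (if k = j then 1 else 0)) = \<Theta>' $$ (i, j)"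
      using ij by (simp add: if_distrib sum.delta cong: if_cong)
    ultimately show ?thesis
      unfolding mult_mat_index_sum[OF C WC ij] left_diff_distrib right_diff_distrib sum_subtractf
      by linarith
  qed
  moreover have "\<bar>\<Sum>k<d2. (C $$ (i, k) - (\<Theta>' * \<Sigma>) $$ (i, k)) * W $$ (k, j)\<bar> \<le> e1 * l11_norm \<Omega>"
  proof -
    have "\<bar>\<Sum>k<d2. (C $$ (i, k) - (\<Theta>' * \<Sigma>) $$ (i, k)) * W $$ (k, j)\<bar> \<le> (\<Sum>k<d2. e1 * \<bar>W $$ (k, j)\<bar>)"
      using C_err[OF ij(1)]
      by (intro sum_abs[THEN order_trans] sum_mono) (auto simp: abs_mult mult_right_mono simp del: index_mult_mat)
    also have "\<dots> \<le> e1 * l11_norm \<Omega>"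
      unfolding sum_distrib_left[symmetric]
      using W_col col_sum_le_l11_norm[OF \<Omega> ij(2)] e by (intro mult_left_mono) auto
    finally show ?thesis .
  qed
  moreover have "\<bar>\<Sum>k<d2. \<Theta>' $$ (i, k) * ((\<Sum>l<d2. \<Sigma> $$ (k, l) * W $$ (l, j)) - (if k = j then 1 else 0))\<bar>
      \<le> 2 * \<gamma> * (m * row_sum_norm (\<Theta> * \<Sigma>) * varpi)"
  proof -
    have "\<bar>\<Sum>k<d2. \<Theta>' $$ (i, k) * ((\<Sum>l<d2. \<Sigma> $$ (k, l) * W $$ (l, j)) - (if k = j then 1 else 0))\<bar>
        \<le> (\<Sum>k<d2. \<bar>\<Theta>' $$ (i, k)\<bar> * (2 * \<gamma>))"
      using resid by (intro sum_abs[THEN order_trans] sum_mono) (auto simp only: abs_mult lessThan_iff intro!: mult_left_mono)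
    also have "\<dots> \<le> (m * row_sum_norm (\<Theta> * \<Sigma>) * varpi) * (2 * \<gamma>)"
      unfolding sum_distrib_right[symmetric] using \<Theta>'_row \<gamma>0 by (intro mult_right_mono) auto
    finally show ?thesis by (simp add: mult.commute)
  qed
  ultimately show ?thesis by linarith
qed

section \<open>Means of truncated samples\<close>

text \<open>For \<open>x = - u < 0\<close> the Taylor bound
  \<open>1 + u + u\<^sup>2 / 2 \<le> exp u\<close> is inverted; the quotient is controlled by the
  identity \<open>(1 - u + u\<^sup>2) * (1 + u + u\<^sup>2 / 2) = 1 + u\<^sup>2 * (1 + u +
  u\<^sup>2) / 2\<close>. The lemma bounds a moment generating function by a first and a second
  moment.\<close>

lemma exp_le_quadratic:
  fixes x :: real
  assumes "\<bar>x\<bar> \<le> 1"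
  shows "exp x \<le> 1 + x + x\<^sup>2"
proof (cases "0 \<le> x")
  case False
  define u where "u = - x"
  have u: "0 < u" "u \<le> 1" using False assms by (auto simp: u_def)
  have "1 + u + u\<^sup>2 / 2 \<le> exp u"
    using exp_lower_Taylor_quadratic[of u] u by simp
  then have "1 / exp u \<le> 1 / (1 + u + u\<^sup>2 / 2)"
    using u by (intro divide_left_mono) (auto intro!: mult_pos_pos add_pos_nonneg)
  also have "\<dots> \<le> 1 - u + u\<^sup>2"
  proof -
    have "(1 - u + u\<^sup>2) * (1 + u + u\<^sup>2 / 2) = 1 + u\<^sup>2 * (1 + u + u\<^sup>2) / 2"
      by (simp add: power2_eq_square field_simps)
    also have "\<dots> \<ge> 1" using u by simp
    finally show ?thesis using u by (subst pos_divide_le_eq) (simp_all add: add_pos_nonneg)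
  qed
  finally show ?thesis by (simp add: u_def exp_minus field_simps)
qed (use assms exp_bound[of x] in auto)

section \<open>The truncation map and its bias\<close>

lemma abs_trunc_le: "0 \<le> \<tau> \<Longrightarrow> \<bar>trunc \<tau> x\<bar> \<le> \<tau>" "0 \<le> \<tau> \<Longrightarrow> \<bar>trunc \<tau> x\<bar> \<le> \<bar>x\<bar>"
  by (auto simp: trunc_def abs_mult sgn_if)

text \<open>Truncation acts only where \<open>\<bar>x\<bar> > \<tau>\<close>, and there
  \<open>\<bar>x\<bar> \<le> x\<^sup>2 / \<tau>\<close>. In expectation, a second moment
  \<open>v\<close> thus limits the bias to \<open>v / \<tau>\<close>.\<close>

lemma trunc_error_le:
  assumes "0 < \<tau>"
  shows "\<bar>trunc \<tau> x - x\<bar> \<le> x\<^sup>2 / \<tau>"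
proof (cases "\<bar>x\<bar> \<le> \<tau>")
  case True
  then have "trunc \<tau> x = x" by (simp add: trunc_def abs_mult_sgn)
  then show ?thesis using assms by simp
next
  case False
  then have "\<bar>trunc \<tau> x - x\<bar> \<le> \<bar>x\<bar>" using assms by (auto simp: trunc_def sgn_if min_def)
  also have "\<bar>x\<bar> * \<tau> \<le> \<bar>x\<bar> * \<bar>x\<bar>" using False by (intro mult_left_mono) auto
  then have "\<bar>x\<bar> \<le> x\<^sup>2 / \<tau>" using assms by (simp add: power2_eq_square field_simps)
  finally show ?thesis .
qed

lemma measurable_trunc [measurable]: "trunc \<tau> \<in> borel_measurable borel"
  unfolding trunc_def by measurable

lemma sets_truncated_mean_deviation:
  assumes [measurable]: "g \<in> borel_measurable M"
  shows "{\<omega> \<in> space (PiM {..<n} (\<lambda>_. M)).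
    \<bar>1 / real n * (\<Sum>i<n. trunc \<tau> (g (\<omega> i))) - c\<bar> > e} \<in> sets (PiM {..<n} (\<lambda>_. M))"
  by measurable

text \<open>Markov's inequality for \<open>exp (a * sum)\<close>. The product measure turns the
  moment generating function into an n-th power, and the quadratic bound with
  \<open>1 + z \<le> exp z\<close> gives \<open>exp (a * E g + a\<^sup>2 * v)\<close> per factor.
  The scale \<open>a\<close> is left free, subject to \<open>\<bar>a * g x\<bar> \<le> 1\<close>,
  and is later taken as the reciprocal of the threshold.\<close>

lemma (in prob_space) chernoff_iid_sum:
  fixes g :: "'a \<Rightarrow> real" and a b v :: real
  assumes g [measurable]: "g \<in> borel_measurable M" and a: "0 < a"
    and bdd: "\<And>x. \<bar>a * g x\<bar> \<le> 1"
    and v: "expectation (\<lambda>x. (g x)\<^sup>2) \<le> v"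
  shows "measure (PiM {..<n} (\<lambda>_. M))
      {\<omega> \<in> space (PiM {..<n} (\<lambda>_. M)). (\<Sum>i<n. g (\<omega> i)) \<ge> real n * expectation g + b}
    \<le> exp (real n * a\<^sup>2 * v - a * b)"
proof -
  interpret S: product_prob_space "\<lambda>_. M" "{..<n}" ..
  have bdd': "\<bar>g x\<bar> \<le> 1 / a" for x
    using bdd[of x] a by (simp add: abs_mult field_simps)
  have int_exp: "integrable M (\<lambda>x. exp (a * g x))"
    using bdd by (intro integrable_const_bound[where B = "exp 1"]) (auto simp: abs_le_iff)
  have int_g: "integrable M g"
    using bdd' by (intro integrable_const_bound[where B = "1 / a"]) auto
  have int_g2: "integrable M (\<lambda>x. (g x)\<^sup>2)"
    using power_mono[OF bdd', of _ 2]
    by (intro integrable_const_bound[where B = "(1 / a)\<^sup>2"]) auto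
  have mgf: "expectation (\<lambda>x. exp (a * g x)) \<le> exp (a * expectation g + a\<^sup>2 * v)"
  proof -
    have "expectation (\<lambda>x. exp (a * g x)) \<le> expectation (\<lambda>x. 1 + a * g x + a\<^sup>2 * (g x)\<^sup>2)"
      using int_exp int_g int_g2 exp_le_quadratic[OF bdd]
      by (intro integral_mono) (auto simp: power_mult_distrib)
    also have "\<dots> = 1 + a * expectation g + a\<^sup>2 * expectation (\<lambda>x. (g x)\<^sup>2)"
      using int_g int_g2 by (simp add: prob_space)
    also have "\<dots> \<le> 1 + (a * expectation g + a\<^sup>2 * v)"
      using v by (simp add: mult_left_mono)
    also have "\<dots> \<le> exp (a * expectation g + a\<^sup>2 * v)"
      by (rule exp_ge_add_one_self)
    finally show ?thesis .
  qed
  let ?N = "PiM {..<n} (\<lambda>_. M)"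
  let ?c = "exp (a * (real n * expectation g + b))"
  have exp_sum: "exp (a * (\<Sum>i<n. g (\<omega> i))) = (\<Prod>i<n. exp (a * g (\<omega> i)))" for \<omega>
    by (simp add: sum_distrib_left exp_sum)
  have "{\<omega> \<in> space ?N. (\<Sum>i<n. g (\<omega> i)) \<ge> real n * expectation g + b}
      = {\<omega> \<in> space ?N. exp (a * (\<Sum>i<n. g (\<omega> i))) \<ge> ?c}"
    using a by auto
  also have "measure ?N \<dots> \<le> (\<integral>\<omega>. exp (a * (\<Sum>i<n. g (\<omega> i))) \<partial>?N) / ?c"
    unfolding exp_sum
    using S.product_integrable_prod[of "{..<n}" "\<lambda>_ x. exp (a * g x)"] int_exp
    by (intro integral_Markov_inequality_measure[where A = "space ?N"]) (auto intro!: AE_I2 prod_nonneg)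
  also have "(\<integral>\<omega>. exp (a * (\<Sum>i<n. g (\<omega> i))) \<partial>?N) = expectation (\<lambda>x. exp (a * g x)) ^ n"
    unfolding exp_sum using int_exp by (subst S.product_integral_prod) auto
  also have "\<dots> \<le> exp (a * expectation g + a\<^sup>2 * v) ^ n"
    using mgf by (intro power_mono integral_nonneg_AE) auto
  also have "\<dots> = exp (real n * (a * expectation g + a\<^sup>2 * v))"
    by (simp flip: exp_of_nat_mult)
  also have "\<dots> / ?c = exp (real n * a\<^sup>2 * v - a * b)"
    by (simp add: algebra_simps flip: exp_diff)
  finally show ?thesis by (simp add: divide_right_mono)
qed

text \<open>With exponential moments at the scale \<open>1 / \<tau>\<close> the Chernoff deviation is \<open>2 * sqrt (v * t / n)\<close>; the
  truncation bias is at most \<open>v / \<tau> = sqrt (v * t / n)\<close>.\<close>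

lemma (in prob_space) truncated_mean_concentration:
  fixes g :: "'a \<Rightarrow> real"
  assumes g [measurable]: "g \<in> borel_measurable M" and int: "integrable M (\<lambda>x. (g x)\<^sup>2)"
    and v: "expectation (\<lambda>x. (g x)\<^sup>2) \<le> v" "0 < v" and t: "0 < t" and n: "0 < n"
    and \<tau>: "\<tau> = sqrt (v * real n / t)"
  shows "measure (PiM {..<n} (\<lambda>_. M)) {\<omega> \<in> space (PiM {..<n} (\<lambda>_. M)).
      \<bar>1 / real n * (\<Sum>i<n. trunc \<tau> (g (\<omega> i))) - expectation g\<bar> > 3 * sqrt (v * t / real n)}
    \<le> 2 * exp (- t)"
proof -
  let ?N = "PiM {..<n} (\<lambda>_. M)"
  interpret S: prob_space ?N by (intro prob_space_PiM prob_space_axioms)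
  have \<tau>0: "0 < \<tau>" using v t n by (simp add: \<tau>)
  define e where "e = sqrt (v * t / real n)"
  have e0: "0 < e" using v t n by (simp add: e_def)
  have e\<tau>: "v / \<tau> = e"
  proof -
    have "e * \<tau> = sqrt ((v * t / real n) * (v * real n / t))"
      unfolding e_def \<tau> by (rule real_sqrt_mult[symmetric])
    also have "(v * t / real n) * (v * real n / t) = v\<^sup>2"
      using t n by (simp add: field_simps power2_eq_square)
    finally show ?thesis using v \<tau>0 by (simp add: field_simps)
  qed
  have \<tau>2: "\<tau>\<^sup>2 * t = v * real n" using v t n by (simp add: \<tau>)
  \<comment> \<open>With \<open>a = 1 / \<tau>\<close> and \<open>b = 2 * n * e\<close>, the
    quadratic term equals \<open>t\<close> and the linear one \<open>2 * t\<close>.\<close>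
  have expo: "real n * (1 / \<tau>)\<^sup>2 * v - 1 / \<tau> * (real n * (2 * e)) = - t"
  proof -
    have "real n * (1 / \<tau>)\<^sup>2 * v = t"
      using \<tau>2 \<tau>0 by (simp add: field_simps)
    moreover have "1 / \<tau> * (real n * (2 * e)) = 2 * (real n * (1 / \<tau>)\<^sup>2 * v)"
      unfolding e\<tau>[symmetric] by (simp add: power2_eq_square)
    ultimately show ?thesis by simp
  qed
  define h where "h = (\<lambda>x. trunc \<tau> (g x))"
  have h [measurable]: "h \<in> borel_measurable M" by (simp add: h_def)
  have sq: "(h x)\<^sup>2 \<le> (g x)\<^sup>2" for x
    using abs_trunc_le(2)[of \<tau> "g x"] \<tau>0 by (simp add: h_def abs_le_square_iff)
  have int_h2: "integrable M (\<lambda>x. (h x)\<^sup>2)"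
    using sq by (intro Bochner_Integration.integrable_bound[OF int]) auto
  have int_h: "integrable M h"
    using abs_trunc_le(1)[of \<tau>] \<tau>0 by (intro integrable_const_bound[where B = \<tau>]) (auto simp: h_def)
  have int_g: "integrable M g" by (rule square_integrable_imp_integrable[OF g int])
  have h_v: "expectation (\<lambda>x. (h x)\<^sup>2) \<le> v"
    using integral_mono[OF int_h2 int sq] v(1) by linarith
  have bias: "\<bar>expectation h - expectation g\<bar> \<le> e"
  proof -
    have "\<bar>expectation h - expectation g\<bar> \<le> expectation (\<lambda>x. \<bar>h x - g x\<bar>)"
      using int_g int_h integral_norm_bound[of M "\<lambda>x. h x - g x"] by simp
    also have "\<dots> \<le> expectation (\<lambda>x. (g x)\<^sup>2 / \<tau>)"
      using int_g int_h int trunc_error_le[OF \<tau>0] by (intro integral_mono) (auto simp: h_def)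
    also have "\<dots> \<le> v / \<tau>" using v(1) \<tau>0 by (simp add: divide_right_mono)
    finally show ?thesis unfolding e\<tau> .
  qed
  define U where "U = {\<omega> \<in> space ?N. (\<Sum>i<n. h (\<omega> i)) \<ge> real n * expectation h + real n * (2 * e)}"
  define L where "L = {\<omega> \<in> space ?N. (\<Sum>i<n. - h (\<omega> i)) \<ge> real n * expectation (\<lambda>x. - h x) + real n * (2 * e)}"
  have bdd: "\<bar>1 / \<tau> * h x\<bar> \<le> 1" for x
    using abs_trunc_le(1)[of \<tau> "g x"] \<tau>0 by (simp add: h_def abs_mult)
  have U: "measure ?N U \<le> exp (- t)"
    unfolding U_def expo[symmetric] using \<tau>0 bdd h_v by (intro chernoff_iid_sum) auto
  have L: "measure ?N L \<le> exp (- t)"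
    unfolding L_def expo[symmetric] using \<tau>0 bdd h_v by (intro chernoff_iid_sum) auto
  have [measurable]: "U \<in> sets ?N" "L \<in> sets ?N" by (simp_all add: U_def L_def)
  \<comment> \<open>Of the deviation \<open>3 * e\<close>, one \<open>e\<close> is absorbed by the
    bias; the remaining \<open>2 * e\<close> around the mean of \<open>h\<close> falls into the
    upper or the lower tail event.\<close>
  have "{\<omega> \<in> space ?N. \<bar>1 / real n * (\<Sum>i<n. trunc \<tau> (g (\<omega> i))) - expectation g\<bar> > 3 * e} \<subseteq> U \<union> L"
  proof safe
    fix \<omega> assume \<omega>: "\<omega> \<in> space ?N" "\<omega> \<notin> L"
      and dev: "\<bar>1 / real n * (\<Sum>i<n. trunc \<tau> (g (\<omega> i))) - expectation g\<bar> > 3 * e"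
    define m where "m = 1 / real n * (\<Sum>i<n. h (\<omega> i))"
    have m: "(\<Sum>i<n. h (\<omega> i)) = real n * m" using n by (simp add: m_def)
    have "\<bar>m - expectation h\<bar> > 2 * e" using dev bias by (simp add: m_def h_def)
    moreover have "m > expectation h - 2 * e"
    proof -
      have "real n * (expectation h - 2 * e) < real n * m"
        using \<omega> by (simp add: L_def sum_negf m algebra_simps)
      then show ?thesis using n by simp
    qed
    ultimately have "expectation h + 2 * e \<le> m" by linarith
    then have "real n * (expectation h + 2 * e) \<le> real n * m" using n by simp
    then show "\<omega> \<in> U" using \<omega> by (simp add: U_def m algebra_simps)
  qed
  then have "measure ?N {\<omega> \<in> space ?N. \<bar>1 / real n * (\<Sum>i<n. trunc \<tau> (g (\<omega> i))) - expectation g\<bar> > 3 * e}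
      \<le> measure ?N (U \<union> L)"
    by (intro S.finite_measure_mono) auto
  also have "\<dots> \<le> measure ?N U + measure ?N L"
    by (intro measure_Un_le) auto
  finally show ?thesis using U L by (simp add: e_def)
qed

section \<open>Stein's identity\<close>

text \<open>A derivative becomes a limit of countably many difference quotients. This yields
  measurability of \<open>deriv f\<close> and of \<open>partial_deriv p j\<close>, neither of which
  has to be continuous.\<close>

lemma DERIV_difference_quotient_LIMSEQ:
  fixes f :: "real \<Rightarrow> real"
  assumes "(f has_real_derivative D) (at x)"
  shows "(\<lambda>n. (f (x + inverse (real (Suc n))) - f x) / inverse (real (Suc n))) \<longlonglongrightarrow> D"
proof -
  have "filterlim (\<lambda>n. inverse (real (Suc n))) (at 0) sequentially"
    using LIMSEQ_inverse_real_of_nat by (simp add: filterlim_at)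
  then show ?thesis
    using assms unfolding DERIV_def by (rule filterlim_compose[rotated])
qed

lemma borel_measurable_deriv:
  fixes f :: "real \<Rightarrow> real"
  assumes f: "\<And>t. f differentiable (at t)"
  shows "f \<in> borel_measurable borel" "deriv f \<in> borel_measurable borel"
proof -
  have "continuous_on UNIV f"
    using f by (simp add: continuous_at_imp_continuous_on differentiable_imp_continuous_within)
  then show [measurable]: "f \<in> borel_measurable borel"
    by (rule borel_measurable_continuous_onI)
  have "(\<lambda>n. (f (t + inverse (real (Suc n))) - f t) / inverse (real (Suc n))) \<longlonglongrightarrow> deriv f t" for t
    using f[of t] by (intro DERIV_difference_quotient_LIMSEQ) (simp add: DERIV_deriv_iff_real_differentiable)
  then show "deriv f \<in> borel_measurable borel"
    by (rule borel_measurable_LIMSEQ_real) measurable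
qed

text \<open>A nonzero limit would keep \<open>\<bar>K\<bar>\<close> above
  \<open>\<bar>c\<bar> / 2\<close> on a half line, a set of infinite measure, against Markov's
  inequality.\<close>

lemma integrable_limit_at_top_eq_0:
  fixes K :: "real \<Rightarrow> real"
  assumes K: "integrable lborel K" and lim: "(K \<longlongrightarrow> c) at_top"
  shows "c = 0"
proof (rule ccontr)
  assume c: "c \<noteq> 0"
  have "((\<lambda>x. \<bar>K x\<bar>) \<longlongrightarrow> \<bar>c\<bar>) at_top" using lim by (rule tendsto_rabs)
  then have "eventually (\<lambda>x. \<bar>K x\<bar> > \<bar>c\<bar> / 2) at_top"
    using c by (intro order_tendstoD) auto
  then obtain B where B: "\<And>x. x \<ge> B \<Longrightarrow> \<bar>K x\<bar> > \<bar>c\<bar> / 2"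
    by (auto simp: eventually_at_top_linorder)
  define E where "E = {x\<in>space lborel. \<bar>K x\<bar> \<ge> \<bar>c\<bar> / 2}"
  have E: "emeasure lborel E < \<infinity>"
    unfolding E_def using K c
    by (intro le_less_trans[OF integral_Markov_inequality[of lborel "\<lambda>x. \<bar>K x\<bar>"]]) auto
  have E_sets: "E \<in> sets lborel" using K unfolding E_def by simp
  have unbounded: "ennreal r \<le> emeasure lborel E" if "0 \<le> r" for r
  proof -
    have "{B..B + r} \<subseteq> E" using B by (auto simp: E_def intro: less_imp_le)
    then have "emeasure lborel {B..B + r} \<le> emeasure lborel E" by (intro emeasure_mono E_sets)
    then show ?thesis using that by simp
  qed
  have "ennreal (enn2real (emeasure lborel E) + 1) \<le> emeasure lborel E"
    by (rule unbounded) simp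
  then show False using E
    by (metis add.commute enn2real_nonneg ennreal_enn2real ennreal_less_iff infinity_ennreal_def
        leD less_add_one)
qed

text \<open>Since only everywhere differentiability is assumed, the fundamental theorem of calculus is
  used in its gauge-integral form; continuity of the derivative is not needed.\<close>

lemma integral_derivative_eq_0:
  fixes G :: "real \<Rightarrow> real"
  assumes deriv: "\<And>x. (G has_real_derivative H x) (at x)"
    and G: "integrable lborel G" and H: "integrable lborel H"
  shows "(\<integral>x. H x \<partial>lborel) = 0"
proof (rule integrable_limit_at_top_eq_0)
  \<comment> \<open>The boundary term over \<open>{-t..t}\<close> is integrable as a function of
    \<open>t\<close> and tends to the integral of \<open>H\<close>, so that integral is zero. Limits
    of \<open>G\<close> at the two ends need not be treated separately.\<close>
  show "integrable lborel (\<lambda>t. G t - G (- t))"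
    using G lborel_integrable_real_affine[OF G, of "-1" 0] by auto
  have "eventually (\<lambda>t. (\<integral>x. indicator {-t..t} x * H x \<partial>lborel) = G t - G (- t)) at_top"
    using eventually_ge_at_top[of 0]
  proof eventually_elim
    case (elim t)
    have "set_integrable lborel {-t..t} H"
      using H unfolding set_integrable_def by (intro integrable_mult_indicator) auto
    from set_borel_integral_eq_integral(2)[OF this]
    have "(\<integral>x. indicator {-t..t} x * H x \<partial>lborel) = integral {-t..t} H"
      by (simp add: set_lebesgue_integral_def)
    also have "(H has_integral (G t - G (- t))) {-t..t}"
      using elim deriv
      by (intro fundamental_theorem_of_calculus)
        (auto intro: has_field_derivative_at_within simp flip: has_real_derivative_iff_has_vector_derivative)
    then have "integral {-t..t} H = G t - G (- t)" by (rule integral_unique)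
    finally show ?case .
  qed
  moreover have "((\<lambda>t. \<integral>x. indicator {-t..t} x * H x \<partial>lborel) \<longlongrightarrow> (\<integral>x. H x \<partial>lborel)) at_top"
  proof (rule integral_dominated_convergence_at_top[where w = "\<lambda>x. \<bar>H x\<bar>"])
    show "AE x in lborel. ((\<lambda>t. indicator {-t..t} x * H x) \<longlongrightarrow> H x) at_top"
    proof (intro AE_I2 tendsto_eventually)
      fix x :: real
      show "eventually (\<lambda>t. indicator {-t..t} x * H x = H x) at_top"
        using eventually_ge_at_top[of "\<bar>x\<bar>"] by eventually_elim (auto simp: indicator_def)
    qed
    show "\<forall>\<^sub>F t in at_top. AE x in lborel. norm (indicator {-t..t} x * H x) \<le> \<bar>H x\<bar>"
      by (intro always_eventually allI AE_I2) (auto simp: indicator_def)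
  qed (use H in \<open>auto\<close>)
  ultimately show "((\<lambda>t. G t - G (- t)) \<longlongrightarrow> (\<integral>x. H x \<partial>lborel)) at_top"
    by (rule Lim_transform_eventually[rotated])
qed

text \<open>Tonelli for \<open>\<bar>f\<bar>\<close>: a finite iterated integral has almost
  everywhere finite inner integrals. This provides the one-dimensional integrability on almost every
  line parallel to an axis.\<close>

lemma (in product_sigma_finite) AE_integrable_fun_upd:
  fixes f :: "('i \<Rightarrow> 'a) \<Rightarrow> real"
  assumes I: "finite I" "i \<notin> I" and f: "integrable (Pi\<^sub>M (insert i I) M) f"
  shows "AE x in Pi\<^sub>M I M. integrable (M i) (\<lambda>y. f (x(i := y)))"
proof -
  have [measurable]: "f \<in> borel_measurable (Pi\<^sub>M (insert i I) M)" using f by auto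
  have upd [measurable]: "(\<lambda>(x, y). x(i := y)) \<in> Pi\<^sub>M I M \<Otimes>\<^sub>M M i \<rightarrow>\<^sub>M Pi\<^sub>M (insert i I) M"
    by (rule measurable_add_dim)
  have "(\<lambda>(x, y). ennreal \<bar>f (x(i := y))\<bar>) = (\<lambda>v. ennreal \<bar>f v\<bar>) \<circ> (\<lambda>(x, y). x(i := y))"
    by auto
  then have "(\<lambda>(x, y). ennreal \<bar>f (x(i := y))\<bar>) \<in> borel_measurable (Pi\<^sub>M I M \<Otimes>\<^sub>M M i)"
    using measurable_comp[OF upd, of "\<lambda>v. ennreal \<bar>f v\<bar>" borel] by simp
  then have inner: "(\<lambda>x. \<integral>\<^sup>+y. ennreal \<bar>f (x(i := y))\<bar> \<partial>M i) \<in> borel_measurable (Pi\<^sub>M I M)"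
    using sigma_finite_measure.borel_measurable_nn_integral[OF sigma_finite_measures] by simp
  have "(\<integral>\<^sup>+x. (\<integral>\<^sup>+y. ennreal \<bar>f (x(i := y))\<bar> \<partial>M i) \<partial>Pi\<^sub>M I M) = (\<integral>\<^sup>+x. ennreal \<bar>f x\<bar> \<partial>Pi\<^sub>M (insert i I) M)"
    using I by (intro product_nn_integral_insert[symmetric]) auto
  also have "\<dots> < \<infinity>" using f by (simp add: integrable_iff_bounded)
  finally have "AE x in Pi\<^sub>M I M. (\<integral>\<^sup>+y. ennreal \<bar>f (x(i := y))\<bar> \<partial>M i) \<noteq> \<infinity>"
    by (intro nn_integral_PInf_AE[OF inner]) auto
  then show ?thesis
    using AE_space
  proof eventually_elim
    case (elim x)
    have "(\<lambda>y. x(i := y)) \<in> M i \<rightarrow>\<^sub>M Pi\<^sub>M (insert i I) M"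
      using elim(2) I by (intro measurable_component_update) auto
    then have "(\<lambda>y. f (x(i := y))) \<in> borel_measurable (M i)"
      by (rule measurable_compose) simp
    then show ?case using elim(1) by (simp add: integrable_iff_bounded less_top)
  qed
qed

section \<open>Partial derivatives and integration by parts in several variables\<close>

lemma space_lborel_vec: "space (lborel_vec d) = extensional {..<d}"
  by (auto simp: space_PiM PiE_def)

lemma sets_lborel_vec: "sets (lborel_vec d) = sets (borel_vec d)"
  by (intro sets_PiM_cong) auto

text \<open>By Fubini, coordinate \<open>j\<close> is integrated first. On almost every line both
  \<open>G\<close> and \<open>H\<close> are integrable, and the one-dimensional result makes the
  inner integral vanish.\<close>

lemma integral_partial_derivative_eq_0:
  assumes j: "j < d"
    and deriv: "\<And>x. x \<in> extensional {..<d} \<Longrightarrow>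
      ((\<lambda>t. G (x(j := t))) has_real_derivative H x) (at (x j))"
    and G: "integrable (lborel_vec d) G" and H: "integrable (lborel_vec d) H"
  shows "(\<integral>x. H x \<partial>lborel_vec d) = 0"
proof -
  interpret product_sigma_finite "\<lambda>_::nat. lborel :: real measure" ..
  let ?I = "{..<d} - {j}"
  have ins: "{..<d} = insert j ?I" using j by auto
  have I: "finite ?I" "j \<notin> ?I" by auto
  have "(\<integral>x. H x \<partial>lborel_vec d) = (\<integral>x. (\<integral>y. H (x(j := y)) \<partial>lborel) \<partial>Pi\<^sub>M ?I (\<lambda>_. lborel))"
    using product_integral_insert[OF I, of H] H ins by simp
  also have "\<dots> = 0"
  proof (rule integral_eq_zero_AE)
    have "AE x in Pi\<^sub>M ?I (\<lambda>_. lborel). integrable lborel (\<lambda>y. G (x(j := y)))"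
      using AE_integrable_fun_upd[OF I, of G] G ins by simp
    moreover have "AE x in Pi\<^sub>M ?I (\<lambda>_. lborel). integrable lborel (\<lambda>y. H (x(j := y)))"
      using AE_integrable_fun_upd[OF I, of H] H ins by simp
    ultimately show "AE x in Pi\<^sub>M ?I (\<lambda>_. lborel). (\<integral>y. H (x(j := y)) \<partial>lborel) = 0"
      using AE_space
    proof eventually_elim
      case (elim x)
      show ?case
      proof (rule integral_derivative_eq_0[OF _ elim(1,2)])
        fix t
        \<comment> \<open>Here \<open>x\<close> is a point over the index set without
          \<open>j\<close>; only after the update does it lie in the domain of
          \<open>deriv\<close>.\<close>
        have "x(j := t) \<in> extensional {..<d}"
          using elim(3) j by (auto simp: space_PiM PiE_def extensional_def)
        from deriv[OF this] show "((\<lambda>y. G (x(j := y))) has_real_derivative H (x(j := t))) (at t)"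
          by simp
      qed
    qed
  qed
  finally show ?thesis .
qed

lemma differentiable_vec_partial_deriv:
  assumes p: "differentiable_vec d p" and x: "x \<in> extensional {..<d}" and j: "j < d"
  shows "((\<lambda>t. p (x(j := t))) has_real_derivative partial_deriv p j x) (at (x j))"
proof -
  obtain g where g: "\<forall>e>0. \<exists>\<delta>>0. \<forall>h \<in> extensional {..<d}. L2_set h {..<d} < \<delta> \<longrightarrow>
        \<bar>p (\<lambda>i\<in>{..<d}. x i + h i) - p x - (\<Sum>i<d. g i * h i)\<bar> \<le> e * L2_set h {..<d}"
    using bspec[OF p[unfolded differentiable_vec_def] x] by blast
  have "((\<lambda>t. p (x(j := t))) has_real_derivative g j) (at (x j))"
    unfolding DERIV_def
  proof (rule LIM_I)
    fix r :: real assume "0 < r"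
    \<comment> \<open>The Frechet expansion is used along \<open>h = u\<close> times the j-th unit
      vector; \<open>r / 2\<close> turns its weak inequality into the strict one of the
      limit.\<close>
    then obtain \<delta> where \<delta>: "\<delta> > 0" and bound: "\<And>h. h \<in> extensional {..<d} \<Longrightarrow> L2_set h {..<d} < \<delta> \<Longrightarrow>
        \<bar>p (\<lambda>i\<in>{..<d}. x i + h i) - p x - (\<Sum>i<d. g i * h i)\<bar> \<le> r / 2 * L2_set h {..<d}"
      using g[rule_format, of "r / 2"] by auto
    have "\<bar>(p (x(j := x j + u)) - p x) / u - g j\<bar> < r" if u: "u \<noteq> 0" "\<bar>u\<bar> < \<delta>" for u
    proof -
      define h where "h = (\<lambda>i\<in>{..<d}. if i = j then u else 0)"
      have norm: "L2_set h {..<d} = \<bar>u\<bar>"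
      proof -
        have "(\<Sum>i<d. (h i)\<^sup>2) = (\<Sum>i<d. if i = j then u\<^sup>2 else 0)"
          by (intro sum.cong) (auto simp: h_def)
        then show ?thesis using j by (simp add: L2_set_def)
      qed
      have "(\<Sum>i<d. g i * h i) = (\<Sum>i<d. if i = j then g j * u else 0)"
        by (intro sum.cong) (auto simp: h_def)
      then have lin: "(\<Sum>i<d. g i * h i) = g j * u" using j by simp
      have "(\<lambda>i\<in>{..<d}. x i + h i) = x(j := x j + u)"
        using x j by (auto simp: h_def extensional_def fun_eq_iff)
      then have "\<bar>p (x(j := x j + u)) - p x - g j * u\<bar> \<le> r / 2 * \<bar>u\<bar>"
        using bound[of h] norm lin u by (simp add: h_def)
      moreover have "(p (x(j := x j + u)) - p x) / u - g j = (p (x(j := x j + u)) - p x - g j * u) / u"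
        using u by (simp add: field_simps)
      ultimately have "\<bar>(p (x(j := x j + u)) - p x) / u - g j\<bar> \<le> r / 2"
        using u by (simp add: field_simps)
      then show ?thesis using \<open>0 < r\<close> by linarith
    qed
    then show "\<exists>s>0. \<forall>u. u \<noteq> 0 \<and> norm (u - 0) < s \<longrightarrow>
        norm ((p (x(j := x j + u)) - p (x(j := x j))) / u - g j) < r"
      using \<delta> by auto
  qed
  then show ?thesis unfolding partial_deriv_def by (metis DERIV_imp_deriv)
qed

lemma borel_measurable_score:
  assumes p: "differentiable_vec d p" and j: "j < d" and meas: "p \<in> borel_measurable (borel_vec d)"
  shows "(\<lambda>x. partial_deriv p j x) \<in> borel_measurable (borel_vec d)"
    and "(\<lambda>x. score p x j) \<in> borel_measurable (borel_vec d)"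
proof -
  note [measurable] = meas
  have upd [measurable]: "(\<lambda>x. x(j := x j + c)) \<in> borel_vec d \<rightarrow>\<^sub>M borel_vec d" for c :: real
  proof (rule measurable_PiM_single')
    show "(\<lambda>x. x(j := x j + c)) \<in> space (borel_vec d) \<rightarrow> {..<d} \<rightarrow>\<^sub>E space borel"
      using j by (auto simp: space_PiM PiE_def extensional_def)
    fix i assume i: "i \<in> {..<d}"
    show "(\<lambda>x. (x(j := x j + c)) i) \<in> borel_measurable (borel_vec d)"
      using i j by (cases "i = j") simp_all
  qed
  show [measurable]: "(\<lambda>x. partial_deriv p j x) \<in> borel_measurable (borel_vec d)"
  proof (rule borel_measurable_LIMSEQ_real)
    fix x assume "x \<in> space (borel_vec d)"
    then have "x \<in> extensional {..<d}" by (auto simp: space_PiM PiE_def)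
    from DERIV_difference_quotient_LIMSEQ[OF differentiable_vec_partial_deriv[OF p this j]]
    show "(\<lambda>n. (p (x(j := x j + inverse (real (Suc n)))) - p x) / inverse (real (Suc n)))
        \<longlonglongrightarrow> partial_deriv p j x" by simp
  qed measurable
  show "(\<lambda>x. score p x j) \<in> borel_measurable (borel_vec d)"
    unfolding score_def by measurable
qed

text \<open>The product of \<open>p x\<close> and \<open>f\<close> of the index has j-th partial
  derivative \<open>H\<close>, whose integral is zero. Through the density, the three integrability
  hypotheses become integrability of this product and of the two parts of \<open>H\<close>; they
  replace any decay condition on \<open>p\<close>.\<close>

lemma stein_identity:
  assumes X: "distributed P (lborel_vec d) X (\<lambda>x. ennreal (p x))"
    and p0: "\<And>x. x \<in> extensional {..<d} \<Longrightarrow> 0 \<le> p x"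
    and p: "differentiable_vec d p" and f: "\<And>t. f differentiable (at t)" and j: "j < d"
    and int_f: "integrable P (\<lambda>\<omega>. f (\<Sum>i<d. X \<omega> i * \<theta> i))"
    and int_f': "integrable P (\<lambda>\<omega>. deriv f (\<Sum>i<d. X \<omega> i * \<theta> i))"
    and int_fS: "integrable P (\<lambda>\<omega>. f (\<Sum>i<d. X \<omega> i * \<theta> i) * score p (X \<omega>) j)"
  shows "(\<integral>\<omega>. f (\<Sum>i<d. X \<omega> i * \<theta> i) * score p (X \<omega>) j \<partial>P) =
    \<theta> j * (\<integral>\<omega>. deriv f (\<Sum>i<d. X \<omega> i * \<theta> i) \<partial>P)"
proof -
  let ?N = "lborel_vec d"
  let ?l = "\<lambda>x :: nat \<Rightarrow> real. \<Sum>i<d. x i * \<theta> i"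
  have nonneg: "\<And>x. x \<in> space ?N \<Longrightarrow> 0 \<le> p x" using p0 by (simp add: space_lborel_vec)
  have meas_eq: "borel_measurable ?N = borel_measurable (borel_vec d)"
    by (intro measurable_cong_sets sets_lborel_vec refl)
  have "p \<in> borel_measurable ?N" using distributed_real_measurable[OF nonneg X] .
  then have p_meas [measurable]: "p \<in> borel_measurable (borel_vec d)" by (simp add: meas_eq)
  note [measurable] = borel_measurable_deriv[OF f] borel_measurable_score[OF p j p_meas]
  have m1: "(\<lambda>x. f (?l x)) \<in> borel_measurable ?N" unfolding meas_eq by measurable
  have m2: "(\<lambda>x. deriv f (?l x)) \<in> borel_measurable ?N" unfolding meas_eq by measurable
  have m3: "(\<lambda>x. f (?l x) * score p x j) \<in> borel_measurable ?N" unfolding meas_eq by measurable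
  \<comment> \<open>A zero of the nonnegative \<open>p\<close> is a minimum along every coordinate
    line. Since \<open>score\<close> is 0 there by division by zero,
    \<open>partial_deriv p j x = - p x * score p x j\<close> holds without exception.\<close>
  have crit: "partial_deriv p j x = 0" if x: "x \<in> extensional {..<d}" and "p x = 0" for x
  proof (rule DERIV_local_min[OF differentiable_vec_partial_deriv[OF p x j], of 1])
    show "\<forall>y. \<bar>x j - y\<bar> < 1 \<longrightarrow> p (x(j := x j)) \<le> p (x(j := y))"
      using x j \<open>p x = 0\<close> by (auto intro!: p0 simp: extensional_def)
  qed simp
  define H where "H = (\<lambda>x. \<theta> j * (p x * deriv f (?l x)) - p x * (f (?l x) * score p x j))"
  have G_int: "integrable ?N (\<lambda>x. p x * f (?l x))"
    using distributed_integrable[OF X m1 nonneg] int_f by simp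
  have f'_int: "integrable ?N (\<lambda>x. p x * deriv f (?l x))"
    using distributed_integrable[OF X m2 nonneg] int_f' by simp
  have fS_int: "integrable ?N (\<lambda>x. p x * (f (?l x) * score p x j))"
    using distributed_integrable[OF X m3 nonneg] int_fS by simp
  have "(\<integral>x. H x \<partial>?N) = 0"
  proof (rule integral_partial_derivative_eq_0[OF j _ G_int])
    show "integrable ?N H" unfolding H_def using f'_int fS_int by auto
    fix x :: "nat \<Rightarrow> real" assume x: "x \<in> extensional {..<d}"
    have "?l (x(j := t)) = t * \<theta> j + (\<Sum>i\<in>{..<d} - {j}. x i * \<theta> i)" for t :: real
      using j by (subst sum.remove[of _ j]) auto
    then have "((\<lambda>t. ?l (x(j := t))) has_real_derivative \<theta> j) (at (x j))"
      by (auto intro!: derivative_eq_intros)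
    moreover have "(f has_real_derivative deriv f (?l x)) (at (?l (x(j := x j))))"
      using f by (simp add: DERIV_deriv_iff_real_differentiable)
    ultimately have "((\<lambda>t. f (?l (x(j := t)))) has_real_derivative deriv f (?l x) * \<theta> j) (at (x j))"
      by (rule DERIV_chain2[rotated])
    from DERIV_mult[OF differentiable_vec_partial_deriv[OF p x j] this]
    have "((\<lambda>t. p (x(j := t)) * f (?l (x(j := t)))) has_real_derivative
        partial_deriv p j x * f (?l x) + deriv f (?l x) * \<theta> j * p x) (at (x j))" by simp
    moreover have "partial_deriv p j x = - p x * score p x j"
      using crit[OF x] by (cases "p x = 0") (auto simp: score_def)
    ultimately show "((\<lambda>t. p (x(j := t)) * f (?l (x(j := t)))) has_real_derivative H x) (at (x j))"
      by (simp add: H_def algebra_simps)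
  qed
  then have "(\<integral>x. p x * (f (?l x) * score p x j) \<partial>?N) = \<theta> j * (\<integral>x. p x * deriv f (?l x) \<partial>?N)"
    unfolding H_def using f'_int fS_int by simp
  then show ?thesis
    using distributed_integral[OF X m2 nonneg] distributed_integral[OF X m3 nonneg] by simp
qed

section \<open>Moments of the model\<close>

lemma (in finite_measure) integrable_fourth_power_imp:
  fixes g :: "'a \<Rightarrow> real"
  assumes g: "g \<in> borel_measurable M" and int: "integrable M (\<lambda>x. g x ^ 4)"
  shows "integrable M (\<lambda>x. (g x)\<^sup>2)" "integrable M g"
proof -
  have "(\<lambda>x. ((g x)\<^sup>2)\<^sup>2) = (\<lambda>x. g x ^ 4)" by (simp flip: power_mult)
  then show sq: "integrable M (\<lambda>x. (g x)\<^sup>2)"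
    using square_integrable_imp_integrable[of "\<lambda>x. (g x)\<^sup>2"] g int by simp
  show "integrable M g" by (rule square_integrable_imp_integrable[OF g sq])
qed

text \<open>The arithmetic-geometric mean inequality for \<open>a\<close> and \<open>b * c\<close>,
  then for the squares of \<open>b\<close> and \<open>c\<close>. The exponents match what is
  available: a square integrable signal and fourth moments of the other two factors.\<close>

lemma abs_mult3_le:
  fixes a b c :: real
  shows "\<bar>a * b * c\<bar> \<le> a\<^sup>2 + (b ^ 4 + c ^ 4)"
proof -
  have two: "2 * \<bar>x * y\<bar> \<le> x\<^sup>2 + y\<^sup>2" for x y :: real
    using sum_squares_bound[of "\<bar>x\<bar>" "\<bar>y\<bar>"] by (simp add: abs_mult)
  have "2 * \<bar>a * b * c\<bar> \<le> a\<^sup>2 + b\<^sup>2 * c\<^sup>2"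
    using two[of a "b * c"] by (simp add: mult.assoc power_mult_distrib)
  moreover have "2 * (b\<^sup>2 * c\<^sup>2) \<le> b ^ 4 + c ^ 4"
    using two[of "b\<^sup>2" "c\<^sup>2"] by (simp add: abs_mult flip: power_mult)
  ultimately show ?thesis by (smt (verit) zero_le_power2 power_mult_distrib abs_ge_zero)
qed

locale vic_setting =
  fixes d1 d2 s :: nat and P :: "obs measure" and p :: "(nat \<Rightarrow> real) \<Rightarrow> real"
    and f :: "nat \<Rightarrow> real \<Rightarrow> real" and \<Theta> \<Omega> :: "real mat" and varpi K q M :: real
  assumes model: "vic_model d1 d2 s P \<Theta>"
    and A1: "assumption_A1 d1 d2 P p f \<Theta> \<Omega> varpi K q"
    and A2: "assumption_A2 d1 d2 P p f \<Theta> M"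
begin

sublocale prob_space P
  using model by (simp add: vic_model_def)

abbreviation "\<Sigma> \<equiv> second_moment d2 P"
abbreviation "link l \<equiv> \<lambda>x. f l (proj_index \<Theta> l x)"
abbreviation "signal \<equiv> \<lambda>\<omega>. \<Sum>l<d2. covZ \<omega> l * link l (covX \<omega>)"
abbreviation "XZ \<equiv> sigma_XZ d1 d2 P"

section \<open>Consequences of the assumptions, measurability and independence\<close>

lemma sets_P: "sets P = sets (borel_vec d1 \<Otimes>\<^sub>M (borel_vec d2 \<Otimes>\<^sub>M (borel :: real measure)))"
  and indep: "indep_var (borel_vec d1) covX (borel_vec d2) covZ"
  and noise_int: "integrable P noise"
  and noise_cond: "AE \<omega> in P. real_cond_exp P XZ noise \<omega> = 0"
  and \<Theta>_carrier: "\<Theta> \<in> carrier_mat d1 d2"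
  and \<Theta>_card: "\<And>j. j < d2 \<Longrightarrow> card {i. i < d1 \<and> \<Theta> $$ (i, j) \<noteq> 0} = s"
  using model by (auto simp: vic_model_def)

lemma M_pos: "0 < M"
  and y4: "integrable P (\<lambda>\<omega>. response f \<Theta> \<omega> ^ 4)" "expectation (\<lambda>\<omega>. response f \<Theta> \<omega> ^ 4) \<le> M"
  and S4: "\<And>j. j < d1 \<Longrightarrow> integrable P (\<lambda>\<omega>. score p (covX \<omega>) j ^ 4)"
    "\<And>j. j < d1 \<Longrightarrow> expectation (\<lambda>\<omega>. score p (covX \<omega>) j ^ 4) \<le> M"
  and Z4: "\<And>k. k < d2 \<Longrightarrow> integrable P (\<lambda>\<omega>. covZ \<omega> k ^ 4)"
    "\<And>k. k < d2 \<Longrightarrow> expectation (\<lambda>\<omega>. covZ \<omega> k ^ 4) \<le> M"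
  using A2 by (auto simp: assumption_A2_def)

lemma p_nonneg: "\<And>x. x \<in> extensional {..<d1} \<Longrightarrow> 0 \<le> p x"
  and X_density: "distributed P (lborel_vec d1) covX (\<lambda>x. ennreal (p x))"
  and p_diff: "differentiable_vec d1 p"
  and f_diff: "\<And>l t. l < d2 \<Longrightarrow> f l differentiable (at t)"
  and link_deriv_int: "\<And>l. l < d2 \<Longrightarrow> integrable P (\<lambda>\<omega>. deriv (f l) (proj_index \<Theta> l (covX \<omega>)))"
  and \<Omega>_carrier: "\<Omega> \<in> carrier_mat d2 d2"
  and \<Omega>_inverse: "\<Sigma> * \<Omega> = 1\<^sub>m d2"
  and \<Omega>_sym: "transpose_mat \<Omega> = \<Omega>"
  and \<Omega>_col_sum: "col_sum_norm \<Omega> \<le> varpi"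
  using A1 by (auto simp: assumption_A1_def pos_def_mat_def inverts_mat_def second_moment_def)

lemma \<Sigma>_carrier: "\<Sigma> \<in> carrier_mat d2 d2"
  by (simp add: second_moment_def)

lemma proj_index_eq: "proj_index \<Theta> l x = (\<Sum>i<d1. x i * \<Theta> $$ (i, l))"
  using \<Theta>_carrier by (simp add: proj_index_def)

lemma response_eq: "response f \<Theta> = (\<lambda>\<omega>. signal \<omega> + noise \<omega>)"
  using \<Theta>_carrier by (simp add: response_def fun_eq_iff)

lemma measurable_P: "measurable P N = measurable (borel_vec d1 \<Otimes>\<^sub>M (borel_vec d2 \<Otimes>\<^sub>M borel)) N"
  by (rule measurable_cong_sets[OF sets_P refl])

lemma measurable_cov [measurable]:
  "covX \<in> P \<rightarrow>\<^sub>M borel_vec d1" "covZ \<in> P \<rightarrow>\<^sub>M borel_vec d2" "noise \<in> borel_measurable P"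
  unfolding measurable_P covX_def[abs_def] covZ_def[abs_def] noise_def[abs_def] by measurable

lemma measurable_covZ_component [measurable]: "k < d2 \<Longrightarrow> (\<lambda>\<omega>. covZ \<omega> k) \<in> borel_measurable P"
  by measurable

lemma measurable_proj_index [measurable]: "proj_index \<Theta> l \<in> borel_measurable (borel_vec d1)"
  unfolding proj_index_eq[abs_def] by measurable

lemma measurable_link [measurable]: "l < d2 \<Longrightarrow> link l \<in> borel_measurable (borel_vec d1)"
  using borel_measurable_deriv(1)[OF f_diff] by measurable

lemma measurable_density: "p \<in> borel_measurable (borel_vec d1)"
proof -
  have "p \<in> borel_measurable (lborel_vec d1)"
    using distributed_real_measurable[OF _ X_density] p_nonneg by (simp add: space_lborel_vec)
  also have "borel_measurable (lborel_vec d1) = borel_measurable (borel_vec d1)"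
    by (intro measurable_cong_sets sets_lborel_vec refl)
  finally show ?thesis .
qed

lemma measurable_score [measurable]:
  "j < d1 \<Longrightarrow> (\<lambda>x. score p x j) \<in> borel_measurable (borel_vec d1)"
  by (rule borel_measurable_score(2)[OF p_diff _ measurable_density])

lemma measurable_signal [measurable]: "signal \<in> borel_measurable P"
  by measurable

lemma measurable_response [measurable]: "response f \<Theta> \<in> borel_measurable P"
  unfolding response_eq by measurable

lemma subalgebra_XZ: "subalgebra P XZ"
  unfolding subalgebra_def sigma_XZ_def
proof
  have pair: "(\<lambda>\<omega>. (covX \<omega>, covZ \<omega>)) \<in> P \<rightarrow>\<^sub>M borel_vec d1 \<Otimes>\<^sub>M borel_vec d2"
    by measurable
  have "(\<lambda>\<omega>. (covX \<omega>, covZ \<omega>)) -` A \<inter> space P \<in> sets P"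
    if "A \<in> sets (borel_vec d1 \<Otimes>\<^sub>M borel_vec d2)" for A
    by (rule measurable_sets[OF pair that])
  moreover have "(\<lambda>\<omega>. (covX \<omega>, covZ \<omega>)) \<in> space P \<rightarrow> space (borel_vec d1 \<Otimes>\<^sub>M borel_vec d2)"
    using measurable_space[OF pair] by (rule funcsetI)
  ultimately show "sets (vimage_algebra (space P) (\<lambda>\<omega>. (covX \<omega>, covZ \<omega>)) (borel_vec d1 \<Otimes>\<^sub>M borel_vec d2)) \<subseteq> sets P"
    by (auto simp: sets_vimage_algebra2)
qed simp

sublocale XZ: finite_measure_subalgebra P XZ
  by unfold_locales (rule subalgebra_XZ)

lemma measurable_XZ:
  "covX \<in> XZ \<rightarrow>\<^sub>M borel_vec d1" "covZ \<in> XZ \<rightarrow>\<^sub>M borel_vec d2"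
proof -
  have pair: "(\<lambda>\<omega>. (covX \<omega>, covZ \<omega>)) \<in> P \<rightarrow>\<^sub>M borel_vec d1 \<Otimes>\<^sub>M borel_vec d2"
    by measurable
  have "(\<lambda>\<omega>. (covX \<omega>, covZ \<omega>)) \<in> XZ \<rightarrow>\<^sub>M borel_vec d1 \<Otimes>\<^sub>M borel_vec d2"
    unfolding sigma_XZ_def
    by (rule measurable_vimage_algebra1) (rule funcsetI, rule measurable_space[OF pair])
  from measurable_compose[OF this measurable_fst] measurable_compose[OF this measurable_snd]
  show "covX \<in> XZ \<rightarrow>\<^sub>M borel_vec d1" "covZ \<in> XZ \<rightarrow>\<^sub>M borel_vec d2" by simp_all
qed

lemma indep_product:
  fixes g h :: "(nat \<Rightarrow> real) \<Rightarrow> real"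
  assumes [measurable]: "g \<in> borel_measurable (borel_vec d1)" "h \<in> borel_measurable (borel_vec d2)"
    and g: "integrable P (\<lambda>\<omega>. g (covX \<omega>))" and h: "integrable P (\<lambda>\<omega>. h (covZ \<omega>))"
  shows "integrable P (\<lambda>\<omega>. g (covX \<omega>) * h (covZ \<omega>))"
    and "expectation (\<lambda>\<omega>. g (covX \<omega>) * h (covZ \<omega>)) =
      expectation (\<lambda>\<omega>. g (covX \<omega>)) * expectation (\<lambda>\<omega>. h (covZ \<omega>))"
proof -
  have "indep_var borel (g \<circ> covX) borel (h \<circ> covZ)"
    by (rule indep_var_compose[OF indep]) measurable
  then have "indep_var borel (\<lambda>\<omega>. g (covX \<omega>)) borel (\<lambda>\<omega>. h (covZ \<omega>))" by (simp add: comp_def)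
  from indep_var_integrable[OF this g h] indep_var_lebesgue_integral[OF this g h]
  show "integrable P (\<lambda>\<omega>. g (covX \<omega>) * h (covZ \<omega>))"
    "expectation (\<lambda>\<omega>. g (covX \<omega>) * h (covZ \<omega>)) =
      expectation (\<lambda>\<omega>. g (covX \<omega>)) * expectation (\<lambda>\<omega>. h (covZ \<omega>))" .
qed

text \<open>Two components of \<open>Z\<close> may be dependent, so the fourth moments enter through
  \<open>2 * a\<^sup>2 * b\<^sup>2 \<le> a ^ 4 + b ^ 4\<close>.\<close>

lemma covZ_product_integrable:
  assumes "k < d2" "l < d2"
  shows "integrable P (\<lambda>\<omega>. covZ \<omega> k * covZ \<omega> l)" "integrable P (\<lambda>\<omega>. (covZ \<omega> k * covZ \<omega> l)\<^sup>2)"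
    "expectation (\<lambda>\<omega>. (covZ \<omega> k * covZ \<omega> l)\<^sup>2) \<le> M"
proof -
  note [measurable] = measurable_covZ_component[OF assms(1)] measurable_covZ_component[OF assms(2)]
  have le: "2 * (covZ \<omega> k * covZ \<omega> l)\<^sup>2 \<le> covZ \<omega> k ^ 4 + covZ \<omega> l ^ 4" for \<omega>
    using sum_squares_bound[of "(covZ \<omega> k)\<^sup>2" "(covZ \<omega> l)\<^sup>2"]
    by (simp add: power_mult_distrib flip: power_mult)
  have int: "integrable P (\<lambda>\<omega>. covZ \<omega> k ^ 4 + covZ \<omega> l ^ 4)" using Z4(1) assms by auto
  show sq: "integrable P (\<lambda>\<omega>. (covZ \<omega> k * covZ \<omega> l)\<^sup>2)"
  proof (rule Bochner_Integration.integrable_bound[OF int])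
    show "AE \<omega> in P. norm ((covZ \<omega> k * covZ \<omega> l)\<^sup>2) \<le> norm (covZ \<omega> k ^ 4 + covZ \<omega> l ^ 4)"
      using le by (intro AE_I2) (smt (verit) real_norm_def zero_le_power2)
  qed measurable
  then show "integrable P (\<lambda>\<omega>. covZ \<omega> k * covZ \<omega> l)"
    by (rule square_integrable_imp_integrable[rotated]) measurable
  have "expectation (\<lambda>\<omega>. 2 * (covZ \<omega> k * covZ \<omega> l)\<^sup>2) \<le> expectation (\<lambda>\<omega>. covZ \<omega> k ^ 4 + covZ \<omega> l ^ 4)"
    using sq int le by (intro integral_mono) auto
  also have "\<dots> \<le> M + M" using add_mono[OF Z4(2)[OF assms(1)] Z4(2)[OF assms(2)]] Z4(1) assms by simp
  finally show "expectation (\<lambda>\<omega>. (covZ \<omega> k * covZ \<omega> l)\<^sup>2) \<le> M" by simp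
qed

text \<open>The signal is the conditional expectation of the response, so Jensen's inequality makes it
  square integrable.\<close>

lemma signal_square_integrable: "integrable P (\<lambda>\<omega>. (signal \<omega>)\<^sup>2)"
proof -
  have y: "integrable P (\<lambda>\<omega>. (response f \<Theta> \<omega>)\<^sup>2)" "integrable P (response f \<Theta>)"
    using integrable_fourth_power_imp[OF measurable_response y4(1)] by auto
  \<comment> \<open>Integrability of the signal has to come from the response: its single summands
    are not yet known to be integrable.\<close>
  have "integrable P (\<lambda>\<omega>. response f \<Theta> \<omega> - noise \<omega>)" using y noise_int by auto
  then have int: "integrable P signal" by (simp add: response_eq)
  note [measurable] = measurable_XZ
  have meas: "signal \<in> borel_measurable XZ" by measurable
  have "AE \<omega> in P. real_cond_exp P XZ (response f \<Theta>) \<omega>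
      = real_cond_exp P XZ signal \<omega> + real_cond_exp P XZ noise \<omega>"
    unfolding response_eq by (rule XZ.real_cond_exp_add[OF int noise_int])
  then have "AE \<omega> in P. real_cond_exp P XZ (response f \<Theta>) \<omega> = signal \<omega>"
    using XZ.real_cond_exp_F_meas[OF int meas] noise_cond by eventually_elim simp
  then have ae: "AE \<omega> in P. (real_cond_exp P XZ (response f \<Theta>) \<omega>)\<^sup>2 = (signal \<omega>)\<^sup>2"
    by eventually_elim simp
  have "integrable P (\<lambda>\<omega>. (real_cond_exp P XZ (response f \<Theta>) \<omega>)\<^sup>2)"
    by (rule XZ.integrable_convex_cond_exp[where I = UNIV]) (use y in \<open>auto simp: convex_power2\<close>)
  then show ?thesis
    by (rule integrable_cong_AE_imp[OF _ _ ae]) measurable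
qed

lemma signal_weight_integrable:
  assumes k: "k < d2" and [measurable]: "\<psi> \<in> borel_measurable (borel_vec d1)"
    and \<psi>: "integrable P (\<lambda>\<omega>. \<psi> (covX \<omega>) ^ 4)"
  shows "integrable P (\<lambda>\<omega>. signal \<omega> * covZ \<omega> k * \<psi> (covX \<omega>))"
proof (rule Bochner_Integration.integrable_bound)
  show "integrable P (\<lambda>\<omega>. (signal \<omega>)\<^sup>2 + (covZ \<omega> k ^ 4 + \<psi> (covX \<omega>) ^ 4))"
    using signal_square_integrable Z4(1)[OF k] \<psi> by auto
  note [measurable] = measurable_covZ_component[OF k]
  show "(\<lambda>\<omega>. signal \<omega> * covZ \<omega> k * \<psi> (covX \<omega>)) \<in> borel_measurable P" by measurable
  show "AE \<omega> in P. norm (signal \<omega> * covZ \<omega> k * \<psi> (covX \<omega>))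
      \<le> norm ((signal \<omega>)\<^sup>2 + (covZ \<omega> k ^ 4 + \<psi> (covX \<omega>) ^ 4))"
    using abs_mult3_le by (intro AE_I2) (auto intro: order_trans[OF _ abs_ge_self])
qed

text \<open>After expanding the signal, independence factors each summand. Integrability of the link
  terms is a hypothesis because the identity is applied first to bounded cut-offs, in order to prove
  it, and then to the score itself.\<close>

lemma expectation_signal_weight:
  assumes k: "k < d2" and [measurable]: "\<phi> \<in> borel_measurable (borel_vec d1)"
    and int: "\<And>l. l < d2 \<Longrightarrow> integrable P (\<lambda>\<omega>. link l (covX \<omega>) * \<phi> (covX \<omega>))"
  shows "expectation (\<lambda>\<omega>. signal \<omega> * covZ \<omega> k * \<phi> (covX \<omega>)) =
    (\<Sum>l<d2. expectation (\<lambda>\<omega>. link l (covX \<omega>) * \<phi> (covX \<omega>)) * \<Sigma> $$ (l, k))"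
proof -
  have prod: "integrable P (\<lambda>\<omega>. link l (covX \<omega>) * \<phi> (covX \<omega>) * (covZ \<omega> l * covZ \<omega> k))"
    "expectation (\<lambda>\<omega>. link l (covX \<omega>) * \<phi> (covX \<omega>) * (covZ \<omega> l * covZ \<omega> k))
      = expectation (\<lambda>\<omega>. link l (covX \<omega>) * \<phi> (covX \<omega>)) * \<Sigma> $$ (l, k)" if l: "l < d2" for l
    using indep_product[of "\<lambda>x. link l x * \<phi> x" "\<lambda>z. z l * z k"]
      int[OF l] covZ_product_integrable(1)[OF l k] measurable_link[OF l] k l
    by (auto simp: second_moment_def)
  have "signal \<omega> * covZ \<omega> k * \<phi> (covX \<omega>) =
      (\<Sum>l<d2. link l (covX \<omega>) * \<phi> (covX \<omega>) * (covZ \<omega> l * covZ \<omega> k))" for \<omega>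
    by (simp add: sum_distrib_left sum_distrib_right mult_ac)
  then show ?thesis using prod by simp
qed

text \<open>Inverting \<open>\<Sigma>\<close> expresses \<open>E[f\<^sub>l \<phi>]\<close> through the moments \<open>E[signal z\<^sub>k \<phi>]\<close>, which are finite. The
  indicator of a region where all links are bounded makes the manipulation legitimate, and
  monotone convergence removes it.\<close>

lemma link_weight_integrable:
  assumes l: "l < d2" and \<psi>_meas [measurable]: "\<psi> \<in> borel_measurable (borel_vec d1)"
    and \<psi>_int: "integrable P (\<lambda>\<omega>. \<psi> (covX \<omega>) ^ 4)"
  shows "integrable P (\<lambda>\<omega>. link l (covX \<omega>) * \<psi> (covX \<omega>))"
proof -
  note [measurable] = measurable_link
  \<comment> \<open>All links are cut off together, not only link \<open>l\<close>, because
    \<open>expectation_signal_weight\<close> involves every one of them.\<close>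
  define \<beta> :: "nat \<Rightarrow> (nat \<Rightarrow> real) \<Rightarrow> real" where
    "\<beta> R x = (if \<forall>l<d2. \<bar>link l x\<bar> \<le> real R then 1 else 0)" for R x
  have \<beta>_meas [measurable]: "\<beta> R \<in> borel_measurable (borel_vec d1)" for R
  proof -
    have "{x \<in> space (borel_vec d1). \<forall>l\<in>{..<d2}. \<bar>link l x\<bar> \<le> real R} \<in> sets (borel_vec d1)"
      by (intro sets.sets_Collect_finite_All' sets.sets_Collect_finite_All) (auto intro!: borel_measurable_le borel_measurable_abs)
    then show ?thesis unfolding \<beta>_def[abs_def] by (intro measurable_If) (auto simp: Ball_def)
  qed
  have \<psi>1: "integrable P (\<lambda>\<omega>. \<psi> (covX \<omega>))"
    by (rule integrable_fourth_power_imp(2)[OF _ \<psi>_int]) measurable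
  \<comment> \<open>The sign makes \<open>link l * \<phi> R\<close> equal to
    \<open>\<bar>link l * \<psi>\<bar>\<close> on the region, while
    \<open>\<bar>\<phi> R\<bar> \<le> \<bar>\<psi>\<bar>\<close> keeps all bounds independent of
    \<open>R\<close>.\<close>
  define \<phi> where "\<phi> R x = sgn (link l x * \<psi> x) * \<psi> x * \<beta> R x" for R x
  have \<phi>_meas [measurable]: "\<phi> R \<in> borel_measurable (borel_vec d1)" for R
    unfolding \<phi>_def[abs_def] using measurable_link[OF l] by measurable
  have \<phi>_le: "\<bar>\<phi> R x\<bar> \<le> \<bar>\<psi> x\<bar>" for R x
    by (auto simp: \<phi>_def \<beta>_def abs_mult sgn_if)
  define g where "g R \<omega> = \<bar>link l (covX \<omega>) * \<psi> (covX \<omega>)\<bar> * \<beta> R (covX \<omega>)" for R \<omega>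
  have g_eq: "g R = (\<lambda>\<omega>. link l (covX \<omega>) * \<phi> R (covX \<omega>))" for R
    by (auto simp: g_def \<phi>_def fun_eq_iff sgn_if abs_if)
  have int: "integrable P (\<lambda>\<omega>. link l' (covX \<omega>) * \<phi> R (covX \<omega>))" if l': "l' < d2" for l' R
  proof (rule Bochner_Integration.integrable_bound)
    show "integrable P (\<lambda>\<omega>. real R * \<psi> (covX \<omega>))" using \<psi>1 by auto
    show "(\<lambda>\<omega>. link l' (covX \<omega>) * \<phi> R (covX \<omega>)) \<in> borel_measurable P"
      using measurable_link[OF l'] by measurable
    have "\<bar>link l' x\<bar> * \<bar>\<phi> R x\<bar> \<le> real R * \<bar>\<psi> x\<bar>" for x
    proof (cases "\<beta> R x = 0")
      case False
      then show ?thesis using l' \<phi>_le[of R x] by (intro mult_mono) (auto simp: \<beta>_def split: if_splits)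
    qed (simp add: \<phi>_def)
    then show "AE \<omega> in P. norm (link l' (covX \<omega>) * \<phi> R (covX \<omega>)) \<le> norm (real R * \<psi> (covX \<omega>))"
      by (simp add: abs_mult)
  qed
  \<comment> \<open>\<open>B\<close> contains \<psi> and not \<open>\<phi> R\<close>, hence is
    uniform in \<open>R\<close>; it involves finite expectations by
    \<open>signal_weight_integrable\<close>.\<close>
  define B where "B = (\<Sum>k<d2. expectation (\<lambda>\<omega>. \<bar>signal \<omega> * covZ \<omega> k * \<psi> (covX \<omega>)\<bar>) * \<bar>\<Omega> $$ (k, l)\<bar>)"
  have bound: "expectation (g R) \<le> B" for R
  proof -
    let ?E = "\<lambda>l'. expectation (\<lambda>\<omega>. link l' (covX \<omega>) * \<phi> R (covX \<omega>))"
    let ?D = "\<lambda>k. expectation (\<lambda>\<omega>. signal \<omega> * covZ \<omega> k * \<phi> R (covX \<omega>))"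
    have inv: "(\<Sum>k<d2. \<Sigma> $$ (l', k) * \<Omega> $$ (k, l)) = (if l' = l then 1 else 0)" if "l' < d2" for l'
    proof -
      have "(\<Sum>k<d2. \<Sigma> $$ (l', k) * \<Omega> $$ (k, l)) = (\<Sigma> * \<Omega>) $$ (l', l)"
        using \<Sigma>_carrier \<Omega>_carrier that l by (simp add: scalar_prod_def atLeast0LessThan)
      then show ?thesis using \<Omega>_inverse that l by simp
    qed
    have "(\<Sum>k<d2. ?D k * \<Omega> $$ (k, l)) = (\<Sum>k<d2. \<Sum>l'<d2. ?E l' * (\<Sigma> $$ (l', k) * \<Omega> $$ (k, l)))"
      using expectation_signal_weight[OF _ \<phi>_meas int]
      by (intro sum.cong) (auto simp: sum_distrib_right mult.assoc)
    also have "\<dots> = (\<Sum>l'<d2. ?E l' * (\<Sum>k<d2. \<Sigma> $$ (l', k) * \<Omega> $$ (k, l)))"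
      by (subst sum.swap) (simp add: sum_distrib_left)
    also have "\<dots> = (\<Sum>l'<d2. if l' = l then ?E l' else 0)"
      using inv by (intro sum.cong) auto
    also have "\<dots> = expectation (g R)" using l by (simp add: g_eq)
    finally have "expectation (g R) = (\<Sum>k<d2. ?D k * \<Omega> $$ (k, l))" ..
    also have "\<dots> \<le> (\<Sum>k<d2. \<bar>?D k\<bar> * \<bar>\<Omega> $$ (k, l)\<bar>)"
      by (intro sum_mono) (simp flip: abs_mult)
    also have "\<dots> \<le> B"
      unfolding B_def
    proof (intro sum_mono mult_right_mono)
      fix k assume "k \<in> {..<d2}"
      then have k: "k < d2" by simp
      note [measurable] = measurable_covZ_component[OF k]
      have int_\<psi>: "integrable P (\<lambda>\<omega>. signal \<omega> * covZ \<omega> k * \<psi> (covX \<omega>))"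
        by (rule signal_weight_integrable[OF k \<psi>_meas \<psi>_int])
      have le: "\<bar>signal \<omega> * covZ \<omega> k * \<phi> R (covX \<omega>)\<bar> \<le> \<bar>signal \<omega> * covZ \<omega> k * \<psi> (covX \<omega>)\<bar>" for \<omega>
        unfolding abs_mult using \<phi>_le by (intro mult_left_mono) auto
      have "integrable P (\<lambda>\<omega>. signal \<omega> * covZ \<omega> k * \<phi> R (covX \<omega>))"
        by (rule Bochner_Integration.integrable_bound[OF int_\<psi>]) (use le in auto)
      then show "\<bar>?D k\<bar> \<le> expectation (\<lambda>\<omega>. \<bar>signal \<omega> * covZ \<omega> k * \<psi> (covX \<omega>)\<bar>)"
        using int_\<psi> le
        by (intro order_trans[OF integral_abs_bound] integral_mono integrable_abs)
    qed auto
    finally show ?thesis .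
  qed
  have g_int: "integrable P (g R)" for R unfolding g_eq by (rule int[OF l])
  have g_mono: "g R \<omega> \<le> g R' \<omega>" if "R \<le> R'" for R R' \<omega>
    using that unfolding g_def by (intro mult_left_mono) (force simp: \<beta>_def)+
  have "convergent (\<lambda>R. expectation (g R))"
  proof (rule Bseq_mono_convergent)
    have "0 \<le> expectation (g R)" for R by (intro integral_nonneg_AE) (auto simp: g_def \<beta>_def)
    then show "Bseq (\<lambda>R. expectation (g R))" using bound by (intro BseqI'[of _ B]) auto
    show "\<forall>R R'. R \<le> R' \<longrightarrow> expectation (g R) \<le> expectation (g R')"
      using g_int g_mono by (auto intro!: integral_mono)
  qed
  then obtain L where L: "(\<lambda>R. expectation (g R)) \<longlonglongrightarrow> L" by (auto simp: convergent_def)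
  have "integrable P (\<lambda>\<omega>. \<bar>link l (covX \<omega>) * \<psi> (covX \<omega>)\<bar>)"
  proof (rule integrable_monotone_convergence[OF g_int _ _ L])
    show "AE \<omega> in P. mono (\<lambda>R. g R \<omega>)" using g_mono by (auto simp: mono_def)
    show "AE \<omega> in P. (\<lambda>R. g R \<omega>) \<longlonglongrightarrow> \<bar>link l (covX \<omega>) * \<psi> (covX \<omega>)\<bar>"
    proof (intro AE_I2 tendsto_eventually)
      fix \<omega>
      obtain R0 :: nat where R0: "(\<Sum>l<d2. \<bar>link l (covX \<omega>)\<bar>) \<le> real R0"
        using real_arch_simple by blast
      have "\<bar>link l' (covX \<omega>)\<bar> \<le> real R" if "R0 \<le> R" "l' < d2" for l' R
        using member_le_sum[of l' "{..<d2}" "\<lambda>l. \<bar>link l (covX \<omega>)\<bar>"] R0 that by simp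
      then have "g R \<omega> = \<bar>link l (covX \<omega>) * \<psi> (covX \<omega>)\<bar>" if "R0 \<le> R" for R
        using that by (simp add: g_def \<beta>_def)
      then show "\<forall>\<^sub>F R in sequentially. g R \<omega> = \<bar>link l (covX \<omega>) * \<psi> (covX \<omega>)\<bar>"
        unfolding eventually_sequentially by blast
    qed
    show "(\<lambda>\<omega>. \<bar>link l (covX \<omega>) * \<psi> (covX \<omega>)\<bar>) \<in> borel_measurable P"
      using measurable_link[OF l] by measurable
  qed
  then show ?thesis
    by (rule integrable_abs_cancel) (use measurable_link[OF l] in measurable)
qed

text \<open>The weighted inequality \<open>2 * u * v \<le> a * u\<^sup>2 + v\<^sup>2 / a\<close>
  with \<open>u\<close> the square of \<open>y\<close> and \<open>v\<close> that of the score times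
  \<open>z\<close>. Independence gives \<open>E v\<^sup>2 \<le> M\<^sup>2\<close>, and the weight
  \<open>a = sqrt M\<close> balances the two terms at \<open>M powr (3/2)\<close> each.\<close>

lemma cross_square:
  assumes j: "j < d1" and k: "k < d2"
  shows "integrable P (\<lambda>\<omega>. (response f \<Theta> \<omega> * score p (covX \<omega>) j * covZ \<omega> k)\<^sup>2)"
    and "expectation (\<lambda>\<omega>. (response f \<Theta> \<omega> * score p (covX \<omega>) j * covZ \<omega> k)\<^sup>2) \<le> M powr (3/2)"
proof -
  note [measurable] = measurable_covZ_component[OF k] measurable_score[OF j]
  let ?y = "response f \<Theta>" and ?S = "\<lambda>\<omega>. score p (covX \<omega>) j"
  define a where "a = sqrt M"
  have a: "0 < a" "a\<^sup>2 = M" using M_pos by (auto simp: a_def)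
  have prod: "integrable P (\<lambda>\<omega>. ?S \<omega> ^ 4 * covZ \<omega> k ^ 4)"
    "expectation (\<lambda>\<omega>. ?S \<omega> ^ 4 * covZ \<omega> k ^ 4) \<le> M * M"
  proof -
    note ip = indep_product[of "\<lambda>x. score p x j ^ 4" "\<lambda>z. z k ^ 4"]
    have m: "(\<lambda>x. score p x j ^ 4) \<in> borel_measurable (borel_vec d1)" by measurable
    have m': "(\<lambda>z. z k ^ 4 :: real) \<in> borel_measurable (borel_vec d2)" using k by (intro borel_measurable_power measurable_component_singleton) simp
    show "integrable P (\<lambda>\<omega>. ?S \<omega> ^ 4 * covZ \<omega> k ^ 4)"
      by (rule ip(1)[OF m m' S4(1)[OF j] Z4(1)[OF k]])
    show "expectation (\<lambda>\<omega>. ?S \<omega> ^ 4 * covZ \<omega> k ^ 4) \<le> M * M"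
      unfolding ip(2)[OF m m' S4(1)[OF j] Z4(1)[OF k]]
      using S4(2)[OF j] Z4(2)[OF k] M_pos by (intro mult_mono integral_nonneg_AE) auto
  qed
  let ?r = "\<lambda>\<omega>. a * ?y \<omega> ^ 4 + (?S \<omega> ^ 4 * covZ \<omega> k ^ 4) / a"
  have le: "2 * (?y \<omega> * ?S \<omega> * covZ \<omega> k)\<^sup>2 \<le> ?r \<omega>" for \<omega>
  proof -
    have "2 * u * v \<le> a * u\<^sup>2 + v\<^sup>2 / a" for u v :: real
    proof -
      have "a * u\<^sup>2 + v\<^sup>2 / a - 2 * u * v = (a * u - v)\<^sup>2 / a"
        using a(1) by (simp add: power2_eq_square field_simps)
      also have "\<dots> \<ge> 0" using a(1) by simp
      finally show ?thesis by simp
    qed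
    from this[of "(?y \<omega>)\<^sup>2" "(?S \<omega>)\<^sup>2 * (covZ \<omega> k)\<^sup>2"] show ?thesis
      by (simp add: power_mult_distrib mult.assoc flip: power_mult)
  qed
  have int: "integrable P ?r" using y4(1) prod(1) by auto
  show sq: "integrable P (\<lambda>\<omega>. (?y \<omega> * ?S \<omega> * covZ \<omega> k)\<^sup>2)"
  proof (rule Bochner_Integration.integrable_bound[OF int])
    show "AE \<omega> in P. norm ((?y \<omega> * ?S \<omega> * covZ \<omega> k)\<^sup>2) \<le> norm (?r \<omega>)"
      using le by (intro AE_I2) (smt (verit) real_norm_def zero_le_power2)
  qed measurable
  have "expectation (\<lambda>\<omega>. 2 * (?y \<omega> * ?S \<omega> * covZ \<omega> k)\<^sup>2) \<le> expectation ?r"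
    using sq int le by (intro integral_mono) auto
  also have "\<dots> = a * expectation (\<lambda>\<omega>. ?y \<omega> ^ 4) + expectation (\<lambda>\<omega>. ?S \<omega> ^ 4 * covZ \<omega> k ^ 4) / a"
    using y4(1) prod(1) by simp
  also have "\<dots> \<le> a * M + M * M / a"
    using y4(2) prod(2) a by (intro add_mono mult_left_mono divide_right_mono) auto
  also have "M * M / a = a * M" using a by (simp add: power2_eq_square field_simps flip: a(2))
  also have "a * M = M powr (3/2)"
  proof -
    have "M powr (3/2) = M powr (1/2) * M powr 1" unfolding powr_add[symmetric] by simp
    then show ?thesis using M_pos by (simp add: a_def powr_half_sqrt)
  qed
  finally show "expectation (\<lambda>\<omega>. (?y \<omega> * ?S \<omega> * covZ \<omega> k)\<^sup>2) \<le> M powr (3/2)" by simp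
qed

section \<open>The target matrix and the mean of the cross products\<close>

lemma Theta_tilde_carrier: "Theta_tilde P f \<Theta> \<in> carrier_mat d1 d2"
  using \<Theta>_carrier by (simp add: Theta_tilde_def)

lemma Theta_tilde_index:
  "i < d1 \<Longrightarrow> j < d2 \<Longrightarrow> Theta_tilde P f \<Theta> $$ (i, j) = mean_deriv P f \<Theta> j * \<Theta> $$ (i, j)"
  using \<Theta>_carrier by (simp add: Theta_tilde_def)

lemma expectation_cross:
  assumes j: "j < d1" and k: "k < d2"
  shows "expectation (\<lambda>\<omega>. response f \<Theta> \<omega> * score p (covX \<omega>) j * covZ \<omega> k) =
    (Theta_tilde P f \<Theta> * \<Sigma>) $$ (j, k)"
proof -
  note [measurable] = measurable_covZ_component[OF k] measurable_score[OF j]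
  let ?y = "response f \<Theta>" and ?S = "\<lambda>\<omega>. score p (covX \<omega>) j"
  have ySz: "integrable P (\<lambda>\<omega>. ?y \<omega> * ?S \<omega> * covZ \<omega> k)"
    by (rule square_integrable_imp_integrable[OF _ cross_square(1)[OF j k]]) measurable
  have mSz: "integrable P (\<lambda>\<omega>. signal \<omega> * covZ \<omega> k * ?S \<omega>)"
    by (rule signal_weight_integrable[OF k measurable_score[OF j] S4(1)[OF j]])
  \<comment> \<open>The noise itself is only assumed integrable; its product with the score and
    \<open>z\<close> is integrable as a difference of two integrable products, so the conditional
    expectation may be used on it.\<close>
  have eq: "?S \<omega> * covZ \<omega> k * noise \<omega> = ?y \<omega> * ?S \<omega> * covZ \<omega> k - signal \<omega> * covZ \<omega> k * ?S \<omega>" for \<omega>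
    by (simp add: response_eq algebra_simps)
  have nSz: "integrable P (\<lambda>\<omega>. ?S \<omega> * covZ \<omega> k * noise \<omega>)"
    unfolding eq using ySz mSz by auto
  have meas: "(\<lambda>\<omega>. ?S \<omega> * covZ \<omega> k) \<in> borel_measurable XZ"
    using measurable_compose[OF measurable_XZ(1) measurable_score[OF j]]
      measurable_compose[OF measurable_XZ(2) measurable_component_singleton[of k "{..<d2}" "\<lambda>_. borel"]] k
    by simp
  have "expectation (\<lambda>\<omega>. ?S \<omega> * covZ \<omega> k * noise \<omega>) =
      expectation (\<lambda>\<omega>. ?S \<omega> * covZ \<omega> k * real_cond_exp P XZ noise \<omega>)"
    using XZ.real_cond_exp_intg(2)[OF nSz meas] by simp
  also have "\<dots> = 0"
    by (rule integral_eq_zero_AE) (use noise_cond in auto)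
  finally have "expectation (\<lambda>\<omega>. ?y \<omega> * ?S \<omega> * covZ \<omega> k) = expectation (\<lambda>\<omega>. signal \<omega> * covZ \<omega> k * ?S \<omega>)"
    unfolding eq using ySz mSz by simp
  also have "\<dots> = (\<Sum>l<d2. expectation (\<lambda>\<omega>. link l (covX \<omega>) * ?S \<omega>) * \<Sigma> $$ (l, k))"
    by (rule expectation_signal_weight[OF k measurable_score[OF j]
          link_weight_integrable[OF _ measurable_score[OF j] S4(1)[OF j]]])
  also have "\<dots> = (\<Sum>l<d2. Theta_tilde P f \<Theta> $$ (j, l) * \<Sigma> $$ (l, k))"
  proof (intro sum.cong refl)
    fix l assume "l \<in> {..<d2}"
    then have l: "l < d2" by simp
    have int: "integrable P (\<lambda>\<omega>. link l (covX \<omega>) * ?S \<omega>)"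
      by (rule link_weight_integrable[OF l measurable_score[OF j] S4(1)[OF j]])
    \<comment> \<open>The constant weight 1 yields integrability of the link alone, which Stein's
      identity also requires.\<close>
    have "integrable P (\<lambda>\<omega>. link l (covX \<omega>) * 1)"
      by (rule link_weight_integrable[OF l]) auto
    then have int1: "integrable P (\<lambda>\<omega>. link l (covX \<omega>))" by simp
    have "expectation (\<lambda>\<omega>. link l (covX \<omega>) * ?S \<omega>) = Theta_tilde P f \<Theta> $$ (j, l)"
      using stein_identity[OF X_density p_nonneg p_diff f_diff[OF l] j, of "\<lambda>i. \<Theta> $$ (i, l)"]
        int int1 link_deriv_int[OF l]
      by (simp add: proj_index_eq Theta_tilde_index[OF j l] mean_deriv_def)
    then show "expectation (\<lambda>\<omega>. link l (covX \<omega>) * ?S \<omega>) * \<Sigma> $$ (l, k) =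
        Theta_tilde P f \<Theta> $$ (j, l) * \<Sigma> $$ (l, k)" by simp
  qed
  also have "\<dots> = (Theta_tilde P f \<Theta> * \<Sigma>) $$ (j, k)"
    using Theta_tilde_carrier \<Sigma>_carrier j k by (simp add: scalar_prod_def atLeast0LessThan)
  finally show ?thesis .
qed

end

section \<open>The error bound\<close>

text \<open>A union bound relative to an event \<open>A\<close>, so that two families with different
  tail bounds can be removed in succession.\<close>

lemma (in prob_space) prob_Diff_UN_ge:
  assumes I: "finite I" and B: "\<And>i. i \<in> I \<Longrightarrow> B i \<in> events" "\<And>i. i \<in> I \<Longrightarrow> prob (B i) \<le> c"
    and A: "A \<in> events"
  shows "prob (A - (\<Union>i\<in>I. B i)) \<ge> prob A - real (card I) * c"
proof -
  have UB: "(\<Union>i\<in>I. B i) \<in> events" using I B by auto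
  have "prob A \<le> prob ((A - (\<Union>i\<in>I. B i)) \<union> (\<Union>i\<in>I. B i))"
    using A UB by (intro finite_measure_mono) auto
  also have "\<dots> \<le> prob (A - (\<Union>i\<in>I. B i)) + prob (\<Union>i\<in>I. B i)"
    using A UB by (intro measure_Un_le) auto
  also have "prob (\<Union>i\<in>I. B i) \<le> (\<Sum>i\<in>I. prob (B i))"
    using I B by (intro finite_measure_subadditive_finite) auto
  also have "\<dots> \<le> (\<Sum>i\<in>I. c)" using B by (intro sum_mono)
  finally show ?thesis by simp
qed

lemma exp_neg_mult_ln:
  assumes "0 < x"
  shows "exp (- (real k * ln x)) = 1 / x ^ k"
  using assms by (simp add: exp_minus exp_of_nat_mult inverse_eq_divide)

lemma sqrt_powr_three_halves: "0 < M \<Longrightarrow> sqrt (M powr (3/2)) = M powr (3/4)"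
  by (simp add: powr_powr flip: powr_half_sqrt)

context vic_setting
begin

text \<open>At level \<open>t = 3 * ln D\<close> with \<open>D = d1 * d2\<close>, each of the
  \<open>D\<close> cross entries fails with probability at most \<open>2 / D ^ 3\<close>, together
  \<open>2 / D\<^sup>2\<close>. At level \<open>t = 5 * ln d2\<close>, each of the
  \<open>d2\<^sup>2\<close> covariance entries fails with probability at most
  \<open>2 / d2 ^ 5\<close>.\<close>

lemma estimation_event:
  assumes d: "1 \<le> d1" "2 \<le> d2" and n: "1 \<le> n"
    and \<tau>1: "\<And>j k. j < d1 \<Longrightarrow> k < d2 \<Longrightarrow>
      \<tau>1 j k = sqrt (M powr (3/2) * real n / (3 * ln (real (d1 * d2))))"
    and \<tau>2: "\<And>k l. k < d2 \<Longrightarrow> l < d2 \<Longrightarrow> \<tau>2 k l = sqrt (M * real n / (5 * ln (real d2)))"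
  obtains A where "A \<in> sets (Pi\<^sub>M {..<n} (\<lambda>_. P))"
    and "measure (Pi\<^sub>M {..<n} (\<lambda>_. P)) A \<ge> 1 - 2 / (real (d1 * d2))\<^sup>2 - 1 / (real d2)\<^sup>2"
    and "\<And>\<omega> j k. \<omega> \<in> A \<Longrightarrow> j < d1 \<Longrightarrow> k < d2 \<Longrightarrow>
      \<bar>cross_hat n d1 d2 \<tau>1 p (\<lambda>i. response f \<Theta> (\<omega> i)) \<omega> $$ (j, k) - (Theta_tilde P f \<Theta> * \<Sigma>) $$ (j, k)\<bar>
        \<le> 3 * sqrt (M powr (3/2) * (3 * ln (real (d1 * d2))) / real n)"
    and "\<And>\<omega> k l. \<omega> \<in> A \<Longrightarrow> k < d2 \<Longrightarrow> l < d2 \<Longrightarrow>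
      \<bar>Sigma_hat n d2 \<tau>2 \<omega> $$ (k, l) - \<Sigma> $$ (k, l)\<bar> \<le> 3 * sqrt (M * (5 * ln (real d2)) / real n)"
proof -
  let ?N = "Pi\<^sub>M {..<n} (\<lambda>_. P)"
  interpret N: prob_space ?N by (intro prob_space_PiM prob_space_axioms)
  define D where "D = real (d1 * d2)"
  have "2 \<le> d1 * d2" using d mult_le_mono[of 1 d1 2 d2] by simp
  then have D: "2 \<le> D" unfolding D_def by linarith
  have L: "0 < ln D" "0 < ln (real d2)" using D d by auto
  define g where "g = (\<lambda>(j, k) \<omega>. response f \<Theta> \<omega> * score p (covX \<omega>) j * covZ \<omega> k)"
  define h where "h = (\<lambda>(k, l) \<omega>. covZ \<omega> k * covZ \<omega> l :: real)"
  define e1 where "e1 = 3 * sqrt (M powr (3/2) * (3 * ln D) / real n)"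
  define e2 where "e2 = 3 * sqrt (M * (5 * ln (real d2)) / real n)"
  define I1 where "I1 = {..<d1} \<times> {..<d2}"
  define I2 where "I2 = {..<d2} \<times> {..<d2}"
  define B1 where "B1 q = {\<omega> \<in> space ?N.
    \<bar>1 / real n * (\<Sum>i<n. trunc (\<tau>1 (fst q) (snd q)) (g q (\<omega> i))) - expectation (g q)\<bar> > e1}" for q
  define B2 where "B2 q = {\<omega> \<in> space ?N.
    \<bar>1 / real n * (\<Sum>i<n. trunc (\<tau>2 (fst q) (snd q)) (h q (\<omega> i))) - expectation (h q)\<bar> > e2}" for q
  have g_meas: "g q \<in> borel_measurable P" if "q \<in> I1" for q
  proof -
    have q: "fst q < d1" "snd q < d2" using that by (auto simp: I1_def)
    note [measurable] = measurable_covZ_component[OF q(2)] measurable_score[OF q(1)]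
    show ?thesis unfolding g_def case_prod_beta by measurable
  qed
  have h_meas: "h q \<in> borel_measurable P" if "q \<in> I2" for q
  proof -
    have q: "fst q < d2" "snd q < d2" using that by (auto simp: I2_def)
    note [measurable] = measurable_covZ_component[OF q(1)] measurable_covZ_component[OF q(2)]
    show ?thesis unfolding h_def case_prod_beta by measurable
  qed
  have B1: "B1 q \<in> N.events" "N.prob (B1 q) \<le> 2 / D ^ 3" if q: "q \<in> I1" for q
  proof -
    show "B1 q \<in> N.events"
      unfolding B1_def by (rule sets_truncated_mean_deviation[OF g_meas[OF q]])
    have q': "fst q < d1" "snd q < d2" using q by (auto simp: I1_def)
    have "N.prob (B1 q) \<le> 2 * exp (- (3 * ln D))"
      unfolding B1_def e1_def
    proof (rule truncated_mean_concentration[OF g_meas[OF q]])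
      show "integrable P (\<lambda>\<omega>. (g q \<omega>)\<^sup>2)" "expectation (\<lambda>\<omega>. (g q \<omega>)\<^sup>2) \<le> M powr (3/2)"
        using cross_square[OF q'] by (simp_all add: g_def case_prod_beta)
      show "\<tau>1 (fst q) (snd q) = sqrt (M powr (3/2) * real n / (3 * ln D))"
        using \<tau>1[OF q'] by (simp add: D_def)
    qed (use L n M_pos in simp_all)
    also have "\<dots> = 2 / D ^ 3" using exp_neg_mult_ln[of D 3] D by simp
    finally show "N.prob (B1 q) \<le> 2 / D ^ 3" .
  qed
  have B2: "B2 q \<in> N.events" "N.prob (B2 q) \<le> 2 / real d2 ^ 5" if q: "q \<in> I2" for q
  proof -
    show "B2 q \<in> N.events"
      unfolding B2_def by (rule sets_truncated_mean_deviation[OF h_meas[OF q]])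
    have q': "fst q < d2" "snd q < d2" using q by (auto simp: I2_def)
    have "N.prob (B2 q) \<le> 2 * exp (- (5 * ln (real d2)))"
      unfolding B2_def e2_def
    proof (rule truncated_mean_concentration[OF h_meas[OF q]])
      show "integrable P (\<lambda>\<omega>. (h q \<omega>)\<^sup>2)" "expectation (\<lambda>\<omega>. (h q \<omega>)\<^sup>2) \<le> M"
        using covZ_product_integrable(2,3)[OF q'] by (simp_all add: h_def case_prod_beta)
    qed (use \<tau>2[OF q'] L n M_pos in simp_all)
    also have "\<dots> = 2 / real d2 ^ 5" using exp_neg_mult_ln[of "real d2" 5] d by simp
    finally show "N.prob (B2 q) \<le> 2 / real d2 ^ 5" .
  qed
  define A1 where "A1 = space ?N - (\<Union>q\<in>I1. B1 q)"
  define A where "A = A1 - (\<Union>q\<in>I2. B2 q)"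
  have fin: "finite I1" "finite I2" by (auto simp: I1_def I2_def)
  have A1: "A1 \<in> N.events" using B1(1) fin by (auto simp: A1_def)
  have A: "A \<in> N.events" using A1 B2(1) fin by (auto simp: A_def)
  have "N.prob A1 \<ge> 1 - real (card I1) * (2 / D ^ 3)"
    unfolding A1_def using N.prob_Diff_UN_ge[OF fin(1) B1 sets.top] N.prob_space by simp
  moreover have "N.prob A \<ge> N.prob A1 - real (card I2) * (2 / real d2 ^ 5)"
    unfolding A_def by (rule N.prob_Diff_UN_ge[OF fin(2) B2 A1])
  moreover have "real (card I1) * (2 / D ^ 3) = 2 / D\<^sup>2"
    using D by (simp add: I1_def D_def power2_eq_square power3_eq_cube)
  \<comment> \<open>The left side is \<open>2 / d2 ^ 3\<close>; the factor 2 is absorbed by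
    \<open>d2 \<ge> 2\<close>.\<close>
  moreover have "real (card I2) * (2 / real d2 ^ 5) \<le> 1 / (real d2)\<^sup>2"
    using d by (simp add: I2_def field_simps power2_eq_square eval_nat_numeral)
  ultimately have prob: "N.prob A \<ge> 1 - 2 / D\<^sup>2 - 1 / (real d2)\<^sup>2" by linarith
  show thesis
  proof (rule that[OF A])
    show "N.prob A \<ge> 1 - 2 / (real (d1 * d2))\<^sup>2 - 1 / (real d2)\<^sup>2"
      using prob by (simp add: D_def)
  next
    fix \<omega> j k assume \<omega>: "\<omega> \<in> A" and jk: "j < d1" "k < d2"
    have "(j, k) \<in> I1" using jk by (simp add: I1_def)
    then have "\<omega> \<in> space ?N" "\<omega> \<notin> B1 (j, k)" using \<omega> by (auto simp: A_def A1_def)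
    then show "\<bar>cross_hat n d1 d2 \<tau>1 p (\<lambda>i. response f \<Theta> (\<omega> i)) \<omega> $$ (j, k)
        - (Theta_tilde P f \<Theta> * \<Sigma>) $$ (j, k)\<bar> \<le> 3 * sqrt (M powr (3/2) * (3 * ln (real (d1 * d2))) / real n)"
      using jk by (simp add: B1_def g_def cross_hat_def e1_def D_def not_less flip: expectation_cross)
  next
    fix \<omega> k l assume \<omega>: "\<omega> \<in> A" and kl: "k < d2" "l < d2"
    have "(k, l) \<in> I2" using kl by (simp add: I2_def)
    then have "\<omega> \<in> space ?N" "\<omega> \<notin> B2 (k, l)" using \<omega> by (auto simp: A_def A1_def)
    then show "\<bar>Sigma_hat n d2 \<tau>2 \<omega> $$ (k, l) - \<Sigma> $$ (k, l)\<bar> \<le> 3 * sqrt (M * (5 * ln (real d2)) / real n)"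
      using kl by (simp add: B2_def h_def Sigma_hat_def e2_def not_less second_moment_def)
  qed
qed

text \<open>The constants \<open>1 / sqrt 3\<close> and \<open>1 / sqrt 5\<close> are the factors 3
  and 5 of the confidence levels inside \<open>sqrt (v * n / t)\<close>. The choice
  \<open>3 * sqrt 5\<close> makes \<gamma> equal to \<open>e2 * varpi\<close>, with
  \<open>e2\<close> the covariance deviation, which is what feasibility of \<Omega> asks
  for.\<close>

lemma estimator_error:
  assumes d1: "1 \<le> d1" and n: "1 \<le> n" and d2: "2 \<le> d2"
    and \<tau>1: "\<forall>j<d1. \<forall>k<d2. \<tau>1 j k = 1 / sqrt 3 * (M powr (3/4) * sqrt (real n / ln (real (d1 * d2))))"
    and \<tau>2: "\<forall>k<d2. \<forall>l<d2. \<tau>2 k l = 1 / sqrt 5 * (M powr (1/2) * sqrt (real n / ln (real d2)))"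
    and \<gamma>: "\<gamma> = 3 * sqrt 5 * (M powr (1/2) * varpi * sqrt (ln (real d2) / real n))"
    and lam: "lam = 8 * M powr (3/4) * l11_norm \<Omega> * sqrt (3 * ln (real (d1 * d2)) / real n)
           + 16 * Max ((\<lambda>j. \<bar>mean_deriv P f \<Theta> j\<bar>) ` {..<d2})
               * row_sum_norm (\<Theta> * \<Sigma>)
               * M powr (1/2) * varpi\<^sup>2 * sqrt (4 * ln (real d2) / real n)"
  shows "\<exists>A \<in> sets (Pi\<^sub>M {..<n} (\<lambda>_. P)).
    measure (Pi\<^sub>M {..<n} (\<lambda>_. P)) A \<ge> 1 - 2 / (real (d1 * d2))\<^sup>2 - 1 / (real d2)\<^sup>2 \<and>
    (\<forall>\<omega>\<in>A. \<forall>W T. is_Omega_hat d2 (Sigma_hat n d2 \<tau>2 \<omega>) \<gamma> W \<longrightarrow>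
       is_Theta_hat d1 d2 (cross_hat n d1 d2 \<tau>1 p (\<lambda>i. response f \<Theta> (\<omega> i)) \<omega>) W lam T \<longrightarrow>
       frob_norm (T - Theta_tilde P f \<Theta>) \<le> 2 * lam * sqrt (real (s * d2)) \<and>
       l11_norm (T - Theta_tilde P f \<Theta>) \<le> 2 * lam * real s * real d2)"
proof -
  let ?N = "Pi\<^sub>M {..<n} (\<lambda>_. P)"
  let ?T = "Theta_tilde P f \<Theta>"
  have M34: "sqrt (M powr (3/2)) = M powr (3/4)" by (rule sqrt_powr_three_halves[OF M_pos])
  have M12: "M powr (1/2) = sqrt M" using M_pos by (simp add: powr_half_sqrt)
  define e1 where "e1 = 3 * sqrt (M powr (3/2) * (3 * ln (real (d1 * d2))) / real n)"
  define e2 where "e2 = 3 * sqrt (M * (5 * ln (real d2)) / real n)"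
  have e1: "e1 = 3 * (M powr (3/4) * sqrt (3 * ln (real (d1 * d2)) / real n))"
    unfolding e1_def M34[symmetric] real_sqrt_mult[symmetric] by simp
  have e2: "e2 = 3 * sqrt 5 * (sqrt M * sqrt (ln (real d2) / real n))"
    unfolding e2_def by (simp add: real_sqrt_mult real_sqrt_divide)
  have \<tau>1': "\<tau>1 j k = sqrt (M powr (3/2) * real n / (3 * ln (real (d1 * d2))))" if "j < d1" "k < d2" for j k
    using \<tau>1 that by (simp add: M34 real_sqrt_mult real_sqrt_divide)
  have \<tau>2': "\<tau>2 k l = sqrt (M * real n / (5 * ln (real d2)))" if "k < d2" "l < d2" for k l
    using \<tau>2 that by (simp add: M12 real_sqrt_mult real_sqrt_divide)
  obtain A where A: "A \<in> sets ?N"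
    and prob: "measure ?N A \<ge> 1 - 2 / (real (d1 * d2))\<^sup>2 - 1 / (real d2)\<^sup>2"
    and cross: "\<And>\<omega> j k. \<omega> \<in> A \<Longrightarrow> j < d1 \<Longrightarrow> k < d2 \<Longrightarrow>
      \<bar>cross_hat n d1 d2 \<tau>1 p (\<lambda>i. response f \<Theta> (\<omega> i)) \<omega> $$ (j, k) - (?T * \<Sigma>) $$ (j, k)\<bar> \<le> e1"
    and Sigma: "\<And>\<omega> k l. \<omega> \<in> A \<Longrightarrow> k < d2 \<Longrightarrow> l < d2 \<Longrightarrow>
      \<bar>Sigma_hat n d2 \<tau>2 \<omega> $$ (k, l) - \<Sigma> $$ (k, l)\<bar> \<le> e2"
  proof (rule estimation_event[where ?\<tau>1.0 = \<tau>1 and ?\<tau>2.0 = \<tau>2, OF d1 d2 n], goal_cases)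
    case (1 j k) show ?case by (rule \<tau>1'[OF 1(2,3)])
  next
    case (2 k l) show ?case by (rule \<tau>2'[OF 2(2,3)])
  next
    case (3 A)
    show ?case by (rule 3(1)[OF 3(2-5)[folded e1_def e2_def]])
  qed
  have bounds: "frob_norm (T - ?T) \<le> 2 * lam * sqrt (real (s * d2)) \<and>
      l11_norm (T - ?T) \<le> 2 * lam * real s * real d2"
    if \<omega>: "\<omega> \<in> A" and W: "is_Omega_hat d2 (Sigma_hat n d2 \<tau>2 \<omega>) \<gamma> W"
      and T: "is_Theta_hat d1 d2 (cross_hat n d1 d2 \<tau>1 p (\<lambda>i. response f \<Theta> (\<omega> i)) \<omega>) W lam T"
    for \<omega> W T
  proof -
    define C where "C = cross_hat n d1 d2 \<tau>1 p (\<lambda>i. response f \<Theta> (\<omega> i)) \<omega>"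
    define m where "m = Max ((\<lambda>j. \<bar>mean_deriv P f \<Theta> j\<bar>) ` {..<d2})"
    define r where "r = row_sum_norm (\<Theta> * \<Sigma>)"
    have C: "C \<in> carrier_mat d1 d2" by (simp add: C_def cross_hat_def)
    have Sh: "Sigma_hat n d2 \<tau>2 \<omega> \<in> carrier_mat d2 d2" by (simp add: Sigma_hat_def)
    have WC: "W \<in> carrier_mat d2 d2" using W by (simp add: is_Omega_hat_def)
    have m_ge: "\<bar>mean_deriv P f \<Theta> j\<bar> \<le> m" if "j < d2" for j
      unfolding m_def using that by (intro Max_ge) auto
    have m0: "0 \<le> m" using m_ge[of 0] d2 by linarith
    have r0: "0 \<le> r"
      unfolding r_def using d1 by (intro row_sum_norm_nonneg[OF mult_carrier_mat[OF \<Theta>_carrier \<Sigma>_carrier]]) simp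
    have \<gamma>_eq: "\<gamma> = e2 * varpi" by (simp add: \<gamma> e2 M12)
    have close: "\<bar>(C * W) $$ (i, j) - ?T $$ (i, j)\<bar> \<le> lam / 2" if ij: "i < d1" "j < d2" for i j
    proof -
      have "\<bar>(C * W) $$ (i, j) - ?T $$ (i, j)\<bar> \<le> e1 * l11_norm \<Omega> + 2 * \<gamma> * (m * r * varpi)"
        unfolding r_def
      proof (rule plug_in_error_bound[OF C \<Theta>_carrier Theta_tilde_carrier \<Sigma>_carrier Sh \<Omega>_carrier
            \<Omega>_inverse \<Omega>_sym _ m0 _ _ \<Omega>_col_sum \<gamma>_eq W ij])
        show "\<bar>?T $$ (i, j)\<bar> \<le> m * \<bar>\<Theta> $$ (i, j)\<bar>" if "i < d1" "j < d2" for i j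
          using that m_ge by (simp add: Theta_tilde_index abs_mult mult_right_mono)
      qed (use cross[OF \<omega>] Sigma[OF \<omega>] in \<open>auto simp: C_def\<close>)
      also have "\<dots> \<le> lam / 2"
      proof -
        \<comment> \<open>In these units the error is \<open>3 * v + 6 * sqrt 5 * w\<close>, whereas
          \<open>lam / 2 = 4 * v + 16 * w\<close>; the 16 is half of 16 times \<open>sqrt 4\<close>.
          Hence \<open>sqrt 5 \<le> 8 / 3\<close> is all that is required.\<close>
        define v where "v = M powr (3/4) * l11_norm \<Omega> * sqrt (3 * ln (real (d1 * d2)) / real n)"
        define w where "w = m * r * (sqrt M * varpi\<^sup>2 * sqrt (ln (real d2) / real n))"
        have w0: "0 \<le> w" using m0 r0 M_pos d2 by (simp add: w_def)
        have "sqrt 5 \<le> 8 / 3" by (rule real_le_lsqrt) (auto simp: power2_eq_square)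
        then have "6 * sqrt 5 * w \<le> 16 * w" using w0 by (intro mult_right_mono) auto
        moreover have "2 * \<gamma> * (m * r * varpi) = 6 * sqrt 5 * w"
          by (simp add: \<gamma> M12 w_def power2_eq_square)
        moreover have "lam = 8 * v + 32 * w"
          by (simp add: lam v_def w_def M12 real_sqrt_mult real_sqrt_divide m_def r_def)
        moreover have "e1 * l11_norm \<Omega> = 3 * v" by (simp add: e1 v_def)
        moreover have "0 \<le> v"
        proof -
          have "1 \<le> d1 * d2" using d1 d2 by (simp add: Suc_le_eq)
          then have "0 \<le> ln (real (d1 * d2))" by (intro ln_ge_zero) linarith
          then show ?thesis by (simp add: v_def l11_norm_nonneg)
        qed
        ultimately show ?thesis by linarith
      qed
      finally show ?thesis .
    qed
    \<comment> \<open>Half of \<open>lam\<close> dominates an absolute value, at any one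
      entry.\<close>
    have lam0: "0 \<le> lam" using close[of 0 0] d1 d2 by linarith
    \<comment> \<open>Scaling a column by \<open>mean_deriv\<close> cannot enlarge its
      support.\<close>
    have sparse: "card {i. i < d1 \<and> ?T $$ (i, j) \<noteq> 0} \<le> s" if j: "j < d2" for j
      unfolding \<Theta>_card[OF j, symmetric] using j by (intro card_mono) (auto simp: Theta_tilde_index)
    note lasso = lasso_error_bounds[OF C WC T[folded C_def] Theta_tilde_carrier lam0 sparse close]
    from lasso show ?thesis by (rule conjI)
  qed
  show ?thesis
    by (intro bexI[OF _ A] conjI prob ballI allI impI bounds)
qed

end

theorem theorem2:
  shows "\<exists>c1 c2 c3 :: real. c1 > 0 \<and> c2 > 0 \<and> c3 > 0 \<and>
    (\<forall>(d1 :: nat) (d2 :: nat) (n :: nat) (s :: nat) (P :: obs measure)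
       (p :: (nat \<Rightarrow> real) \<Rightarrow> real) (f :: nat \<Rightarrow> real \<Rightarrow> real) (\<Theta> :: real mat) (\<Omega> :: real mat)
       (varpi :: real) (K :: real) (q :: real) (M :: real)
       (\<tau>1 :: nat \<Rightarrow> nat \<Rightarrow> real) (\<tau>2 :: nat \<Rightarrow> nat \<Rightarrow> real) (\<gamma> :: real) (lam :: real).
       d1 \<ge> 1 \<longrightarrow> n \<ge> 1 \<longrightarrow> d2 \<ge> 2 \<longrightarrow> s \<ge> 1 \<longrightarrow>
       vic_model d1 d2 s P \<Theta> \<longrightarrow>
       assumption_A1 d1 d2 P p f \<Theta> \<Omega> varpi K q \<longrightarrow>
       assumption_A2 d1 d2 P p f \<Theta> M \<longrightarrow>
       (\<forall>j<d1. \<forall>k<d2. \<tau>1 j k = c1 * (M powr (3/4) * sqrt (real n / ln (real (d1 * d2))))) \<longrightarrow>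
       (\<forall>k<d2. \<forall>l<d2. \<tau>2 k l = c2 * (M powr (1/2) * sqrt (real n / ln (real d2)))) \<longrightarrow>
       \<gamma> = c3 * (M powr (1/2) * varpi * sqrt (ln (real d2) / real n)) \<longrightarrow>
       lam = 8 * M powr (3/4) * l11_norm \<Omega> * sqrt (3 * ln (real (d1 * d2)) / real n)
           + 16 * Max ((\<lambda>j. \<bar>mean_deriv P f \<Theta> j\<bar>) ` {..<d2})
               * row_sum_norm (\<Theta> * second_moment d2 P)
               * M powr (1/2) * varpi\<^sup>2 * sqrt (4 * ln (real d2) / real n) \<longrightarrow>
       (\<exists>A \<in> sets (Pi\<^sub>M {..<n} (\<lambda>_. P)).
          measure (Pi\<^sub>M {..<n} (\<lambda>_. P)) A
            \<ge> 1 - 2 / (real (d1 * d2))\<^sup>2 - 1 / (real d2)\<^sup>2 - 1 / (real d2) ^ 3 \<and>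
          (\<forall>\<omega>\<in>A. \<forall>Omega_hat Theta_hat.
             is_Omega_hat d2 (Sigma_hat n d2 \<tau>2 \<omega>) \<gamma> Omega_hat \<longrightarrow>
             is_Theta_hat d1 d2
               (cross_hat n d1 d2 \<tau>1 p (\<lambda>i. response f \<Theta> (\<omega> i)) \<omega>) Omega_hat lam Theta_hat \<longrightarrow>
             frob_norm (Theta_hat - Theta_tilde P f \<Theta>) \<le> 2 * lam * sqrt (real (s * d2)) \<and>
             l11_norm (Theta_hat - Theta_tilde P f \<Theta>) \<le> 8 * lam * real s * real d2)))"
proof (rule exI[of _ "1 / sqrt 3"], rule exI[of _ "1 / sqrt 5"], rule exI[of _ "3 * sqrt 5"],
    intro conjI allI impI)
  fix d1 d2 n s :: nat and P :: "obs measure" and p :: "(nat \<Rightarrow> real) \<Rightarrow> real"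
    and f :: "nat \<Rightarrow> real \<Rightarrow> real" and \<Theta> \<Omega> :: "real mat" and varpi K q M :: real
    and \<tau>1 \<tau>2 :: "nat \<Rightarrow> nat \<Rightarrow> real" and \<gamma> lam :: real
  assume d1: "1 \<le> d1" and n: "1 \<le> n" and d2: "2 \<le> d2"
    and setting: "vic_model d1 d2 s P \<Theta>" "assumption_A1 d1 d2 P p f \<Theta> \<Omega> varpi K q"
      "assumption_A2 d1 d2 P p f \<Theta> M"
    and \<tau>1: "\<forall>j<d1. \<forall>k<d2. \<tau>1 j k = 1 / sqrt 3 * (M powr (3/4) * sqrt (real n / ln (real (d1 * d2))))"
    and \<tau>2: "\<forall>k<d2. \<forall>l<d2. \<tau>2 k l = 1 / sqrt 5 * (M powr (1/2) * sqrt (real n / ln (real d2)))"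
    and \<gamma>: "\<gamma> = 3 * sqrt 5 * (M powr (1/2) * varpi * sqrt (ln (real d2) / real n))"
    and lam: "lam = 8 * M powr (3/4) * l11_norm \<Omega> * sqrt (3 * ln (real (d1 * d2)) / real n)
           + 16 * Max ((\<lambda>j. \<bar>mean_deriv P f \<Theta> j\<bar>) ` {..<d2})
               * row_sum_norm (\<Theta> * second_moment d2 P)
               * M powr (1/2) * varpi\<^sup>2 * sqrt (4 * ln (real d2) / real n)"
  from vic_setting.estimator_error[OF vic_setting.intro[OF setting] d1 n d2 \<tau>1 \<tau>2 \<gamma> lam]
  obtain A where A: "A \<in> sets (Pi\<^sub>M {..<n} (\<lambda>_. P))"
    and prob: "measure (Pi\<^sub>M {..<n} (\<lambda>_. P)) A \<ge> 1 - 2 / (real (d1 * d2))\<^sup>2 - 1 / (real d2)\<^sup>2"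
    and bounds: "\<forall>\<omega>\<in>A. \<forall>W T. is_Omega_hat d2 (Sigma_hat n d2 \<tau>2 \<omega>) \<gamma> W \<longrightarrow>
       is_Theta_hat d1 d2 (cross_hat n d1 d2 \<tau>1 p (\<lambda>i. response f \<Theta> (\<omega> i)) \<omega>) W lam T \<longrightarrow>
       frob_norm (T - Theta_tilde P f \<Theta>) \<le> 2 * lam * sqrt (real (s * d2)) \<and>
       l11_norm (T - Theta_tilde P f \<Theta>) \<le> 2 * lam * real s * real d2"
    by (elim bexE conjE)
  \<comment> \<open>The event found has probability above the claimed bound; the difference is this
    nonnegative term.\<close>
  have "0 \<le> 1 / real d2 ^ 3" by simp
  with prob have prob': "1 - 2 / (real (d1 * d2))\<^sup>2 - 1 / (real d2)\<^sup>2 - 1 / (real d2) ^ 3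
      \<le> measure (Pi\<^sub>M {..<n} (\<lambda>_. P)) A" by linarith
  have bounds': "frob_norm (T - Theta_tilde P f \<Theta>) \<le> 2 * lam * sqrt (real (s * d2)) \<and>
      l11_norm (T - Theta_tilde P f \<Theta>) \<le> 8 * lam * real s * real d2"
    if "\<omega> \<in> A" "is_Omega_hat d2 (Sigma_hat n d2 \<tau>2 \<omega>) \<gamma> W"
      "is_Theta_hat d1 d2 (cross_hat n d1 d2 \<tau>1 p (\<lambda>i. response f \<Theta> (\<omega> i)) \<omega>) W lam T" for \<omega> W T
  proof -
    have le: "frob_norm (T - Theta_tilde P f \<Theta>) \<le> 2 * lam * sqrt (real (s * d2))"
      "l11_norm (T - Theta_tilde P f \<Theta>) \<le> 2 * lam * real s * real d2"
      using bounds that by blast+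
    \<comment> \<open>Passing from the factor 2 to 8 needs \<open>lam * s * d2 \<ge> 0\<close>,
      which holds because \<open>2 * lam * s * d2\<close> dominates a norm.\<close>
    show ?thesis using le l11_norm_nonneg[of "T - Theta_tilde P f \<Theta>"] by (simp add: mult.assoc)
  qed
  show "\<exists>A \<in> sets (Pi\<^sub>M {..<n} (\<lambda>_. P)). measure (Pi\<^sub>M {..<n} (\<lambda>_. P)) A
            \<ge> 1 - 2 / (real (d1 * d2))\<^sup>2 - 1 / (real d2)\<^sup>2 - 1 / (real d2) ^ 3 \<and>
          (\<forall>\<omega>\<in>A. \<forall>Omega_hat Theta_hat.
             is_Omega_hat d2 (Sigma_hat n d2 \<tau>2 \<omega>) \<gamma> Omega_hat \<longrightarrow>
             is_Theta_hat d1 d2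
               (cross_hat n d1 d2 \<tau>1 p (\<lambda>i. response f \<Theta> (\<omega> i)) \<omega>) Omega_hat lam Theta_hat \<longrightarrow>
             frob_norm (Theta_hat - Theta_tilde P f \<Theta>) \<le> 2 * lam * sqrt (real (s * d2)) \<and>
             l11_norm (Theta_hat - Theta_tilde P f \<Theta>) \<le> 8 * lam * real s * real d2)"
    by (intro bexI[OF _ A] conjI[OF prob'] ballI allI impI bounds')
qed simp_all

end
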